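(* Consider the flag manifold $M={\rm SU}(3)/T^2$ equipped with an ${\rm SU}(3)$-invariant almost Hermitian structure $(g,J)$, where the invariant metric $g$ is parametrized by a triple of positive numbers $(x,y,z)$ and $J$ is a non-integrable invariant almost complex structure. Let $s_1$ be the first Hermitian scalar curvature of $(g,J)$ and $s$ the Riemannian scalar curvature of $g$. Then $2s_1-s=0$ if and only if $(g,J)\in\mathcal{W}_1\oplus\mathcal{W}_2$ and the metric $g$ satisfies one of the following relations: (1) $z=3(x+y)-2\sqrt{2}\sqrt{x^2+3xy+y^2}$, with $x>0$ and either $y>(2\sqrt{2}+3)x$ or $0<y<(3-2\sqrt{2})x$; (2) $z=2\sqrt{2}\sqrt{x^2+3xy+y^2}+3(x+y)$, with $x>0$ and $y>0$.
   Context: Metrics and almost complex structures. $T^2\subset {\rm SU}(3)$ is the maximal torus of diagonal matrices. Write $\mathfrak{su}(3)=\mathfrak t\oplus\mathfrak m$ with $\mathfrak m=\mathfrak u_{12}\oplus\mathfrak u_{23}\oplus\mathfrak u_{13}$, $\mathfrak u_{ij}=\mathfrak{su}(3)\cap(\mathfrak g_{\alpha_{ij}}\oplus\mathfrak g_{-\alpha_{ij}})$, where $\alpha_{ij}=x_i-x_j$ are the roots of $\mathfrak{sl}(3,\mathbb C)$ and $\mathfrak g_{\alpha}$ denotes the root space; $\mathfrak m$ is identified with the tangent space at the trivial coset. The invariant metric with parameters $(x,y,z)=(\lambda_{12},\lambda_{23},\lambda_{13})$ is induced by the inner product on $\mathfrak m$ equal to $-\lambda_{ij}B$ on $\mathfrak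 u_{ij}$ (different $\mathfrak u_{ij}$ orthogonal), $B$ being the Killing form. An invariant almost complex structure is given on $\mathfrak m^{\mathbb C}$ by $JX=\sqrt{-1}\,\varepsilon_\alpha X$ for $X\in\mathfrak g_\alpha$, with signs $\varepsilon_\alpha=\pm1$, $\varepsilon_{-\alpha}=-\varepsilon_\alpha$. Up to conjugation and equivalence there are two: $(\varepsilon_{12},\varepsilon_{23},\varepsilon_{13})=(+,+,+)$ (integrable) and $(+,+,-)$ (non-integrable). Hermitian scalar curvature. For an almost Hermitian manifold $(M,g,J)$ with Levi-Civita connection $D$, let $\nabla^t$ ($t\in\mathbb R$) be the Gauduchon connections $g(\nabla^{t}_{X}Z,Y)=g(D_{X}Z,Y)-\frac12 g(J(D_{X}J)Z,Y)+\frac t4 g((D_{JY}J+JD_{Y}J)X,Z)-\frac t4 g((D_{JZ}J+JD_{Z}J)X,Y)$; $\nabla^1$ is the Chern connection. With $R^t(X,Y,Z,W)=-g(([\nabla^t_X,\nabla^t_Y]-\nabla^t_{[X,Y]})Z,W)$ extended complex multilinearly and $\{u_i\}$ a unitary frame of $T^{1,0}M$ ($u_{\bar i}=\overline{u_i}$), put $s_1(t)=\sum_{i,j}R^t(u_{\bar i},u_i,u_j,u_{\bar j})$ (sign normalised so that $s_1=s/2$ for Kähler structures). On flag manifolds with invariant $(g,J)$, $s_1(t)$ does not depend on $t$ and is denoted $s_1$; it is the Chern scalar curvature $s_1(1)$. Gray–Hervella classes. $F(X,Y)=g(JX,Y)$; $(dF)^-$ and $(dF)^+$ are the $(3,0)+(0,3)$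 and $(2,1)+(1,2)$ parts of $dF$, and $(dF)^+_0$ is the primitive part of $(dF)^+$; $\alpha_F=J\delta F$ is the Lee form; $N(X,Y)=[X,Y]-[JX,JY]+J[JX,Y]+J[X,JY]$ and $N^0=N-\mathfrak bN$, where $N(X,Y,Z)=g(N(X,Y),Z)$ and $\mathfrak bN(X,Y,Z)=\frac13[N(X,Y,Z)+N(Y,Z,X)+N(Z,X,Y)]$. $(g,J)\in\mathcal W_1\oplus\mathcal W_2$ means $(dF)^+_0=0$ and $\alpha_F=0$. *)

theory Defs
  imports "HOL-Analysis.Analysis"
begin

text \<open>
  Differential geometry on \<open>M = SU(3)/T\<^sup>2\<close>. A point of \<open>M\<close> is represented by any \<open>p\<close> in its coset
  \<open>pT\<^sup>2\<close>. The map \<open>v \<mapsto> d/dt (p exp(tv) T\<^sup>2)\<close> at \<open>t = 0\<close> identifies \<open>\<mm>\<close> with the tangent space of \<open>M\<close>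
  at \<open>pT\<^sup>2\<close>; replacing \<open>p\<close> by \<open>pt\<close> replaces \<open>v\<close> by \<open>Ad(t\<^sup>-\<^sup>1)v\<close>, i.e. \<open>TM = SU(3) \<times>\<^bsub>T\<^esub> \<mm>\<close>. Hence functions
  on \<open>M\<close> are right \<open>T\<^sup>2\<close>-invariant functions on \<open>SU(3)\<close>, and vector fields on \<open>M\<close> are
  \<open>T\<^sup>2\<close>-equivariant maps \<open>SU(3) \<rightarrow> \<mm>\<close>. Invariant tensors are constant in this picture. Maps are
  typed on all matrices, but only their values on \<open>SU(3)\<close> are meaningful.
\<close>

type_synonym mat3 = "complex^3^3"
type_synonym vfield = "mat3 \<Rightarrow> mat3"

section \<open>The Lie group, the Lie algebra and the isotropy representation\<close>

definition herm_adj :: "mat3 \<Rightarrow> mat3" where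
  "herm_adj A = (\<chi> i j. cnj (A $ j $ i))"

definition cscale :: "complex \<Rightarrow> mat3 \<Rightarrow> mat3" where
  "cscale c A = (\<chi> i j. c * A $ i $ j)"

definition comm :: "mat3 \<Rightarrow> mat3 \<Rightarrow> mat3" where
  "comm A B = A ** B - B ** A"

definition diagonal :: "mat3 \<Rightarrow> bool" where
  "diagonal A \<longleftrightarrow> (\<forall>i j. i \<noteq> j \<longrightarrow> A $ i $ j = 0)"

definition SU3 :: "mat3 set" where
  "SU3 = {A. A ** herm_adj A = mat 1 \<and> det A = 1}"

definition torus :: "mat3 set" where
  "torus = {A \<in> SU3. diagonal A}"

definition su3 :: "mat3 set" where
  "su3 = {A. herm_adj A = - A \<and> trace A = 0}"

text \<open>The root space of \<open>\<alpha>\<^sub>i\<^sub>j = x\<^sub>i - x\<^sub>j\<close> in \<open>sl(3,\<complex>)\<close>.\<close>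

definition root_space :: "3 \<Rightarrow> 3 \<Rightarrow> mat3 set" where
  "root_space i j = {X. trace X = 0 \<and>
     (\<forall>H. diagonal H \<and> trace H = 0 \<longrightarrow> comm H X = cscale (H $ i $ i - H $ j $ j) X)}"

definition uu :: "3 \<Rightarrow> 3 \<Rightarrow> mat3 set" where
  "uu i j = su3 \<inter> {X + Y | X Y. X \<in> root_space i j \<and> Y \<in> root_space j i}"

definition mm :: "mat3 set" where
  "mm = {a + b + c | a b c. a \<in> uu 1 2 \<and> b \<in> uu 2 3 \<and> c \<in> uu 1 3}"

text \<open>The component in \<open>\<uu>\<^sub>i\<^sub>j\<close>, and the projection along the diagonal matrices onto \<open>\<mm>\<close>.\<close>

definition uu_part :: "3 \<Rightarrow> 3 \<Rightarrow> mat3 \<Rightarrow> mat3" where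
  "uu_part i j X = (\<chi> k l. if (k, l) = (i, j) \<or> (k, l) = (j, i) then X $ k $ l else 0)"

definition mm_part :: "mat3 \<Rightarrow> mat3" where
  "mm_part X = uu_part 1 2 X + uu_part 2 3 X + uu_part 1 3 X"

definition unit_mat :: "3 \<Rightarrow> 3 \<Rightarrow> mat3" where
  "unit_mat i j = (\<chi> k l. if (k, l) = (i, j) then 1 else 0)"

text \<open>The Killing form \<open>B(X,Y) = tr (ad X \<circ> ad Y)\<close>. The trace is taken on \<open>gl(3,\<complex>) = sl(3,\<complex>) \<oplus> \<complex>\<cdot>1\<close>,
  where the centre contributes nothing. On \<open>su(3)\<close> it is real.\<close>

definition killing :: "mat3 \<Rightarrow> mat3 \<Rightarrow> complex" where
  "killing X Y = (\<Sum>i\<in>UNIV. \<Sum>j\<in>UNIV. comm X (comm Y (unit_mat i j)) $ i $ j)"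

section \<open>Invariant metrics and almost complex structures\<close>

definition inv_metric :: "real \<Rightarrow> real \<Rightarrow> real \<Rightarrow> mat3 \<Rightarrow> mat3 \<Rightarrow> real" where
  "inv_metric x y z X Y =
     - x * Re (killing (uu_part 1 2 X) (uu_part 1 2 Y))
     - y * Re (killing (uu_part 2 3 X) (uu_part 2 3 Y))
     - z * Re (killing (uu_part 1 3 X) (uu_part 1 3 Y))"

definition sign_choice :: "(3 \<Rightarrow> 3 \<Rightarrow> real) \<Rightarrow> bool" where
  "sign_choice \<epsilon> \<longleftrightarrow> (\<forall>i j. i \<noteq> j \<longrightarrow> (\<epsilon> i j = 1 \<or> \<epsilon> i j = -1) \<and> \<epsilon> j i = - \<epsilon> i j)"

text \<open>\<open>JX = \<i> \<epsilon>\<^sub>\<alpha> X\<close> on \<open>\<gg>\<^sub>\<alpha>\<close>. This is the complex linear map on \<open>\<mm>\<^sup>\<complex>\<close>; it preserves \<open>\<mm>\<close>.\<close>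

definition inv_acs :: "(3 \<Rightarrow> 3 \<Rightarrow> real) \<Rightarrow> mat3 \<Rightarrow> mat3" where
  "inv_acs \<epsilon> X = (\<chi> k l. \<i> * of_real (\<epsilon> k l) * X $ k $ l)"

section \<open>Smooth functions and vector fields\<close>

text \<open>The derivative of a map on \<open>SU(3)\<close> at \<open>p\<close> along the left-invariant field of \<open>v \<in> su(3)\<close>. The
  Frechet derivative within \<open>SU(3)\<close> is unique on vectors \<open>pv\<close>, which are tangent to \<open>SU(3)\<close>.\<close>

definition left_deriv :: "(mat3 \<Rightarrow> 'a::real_normed_vector) \<Rightarrow> mat3 \<Rightarrow> mat3 \<Rightarrow> 'a" where
  "left_deriv f p v = frechet_derivative f (at p within SU3) (p ** v)"

primrec C_k_on_SU3 :: "nat \<Rightarrow> (mat3 \<Rightarrow> 'a::real_normed_vector) \<Rightarrow> bool" where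
  "C_k_on_SU3 0 f \<longleftrightarrow> continuous_on SU3 f"
| "C_k_on_SU3 (Suc k) f \<longleftrightarrow> (\<forall>p\<in>SU3. f differentiable (at p within SU3)) \<and>
     (\<forall>v\<in>su3. C_k_on_SU3 k (\<lambda>p. left_deriv f p v))"

definition smooth_SU3 :: "(mat3 \<Rightarrow> 'a::real_normed_vector) \<Rightarrow> bool" where
  "smooth_SU3 f \<longleftrightarrow> (\<forall>k. C_k_on_SU3 k f)"

definition smooth_fun :: "(mat3 \<Rightarrow> real) \<Rightarrow> bool" where
  "smooth_fun \<phi> \<longleftrightarrow> smooth_SU3 \<phi> \<and> (\<forall>p\<in>SU3. \<forall>t\<in>torus. \<phi> (p ** t) = \<phi> p)"

definition smooth_vfield :: "vfield \<Rightarrow> bool" where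
  "smooth_vfield X \<longleftrightarrow> smooth_SU3 X \<and> (\<forall>p\<in>SU3. X p \<in> mm) \<and>
     (\<forall>p\<in>SU3. \<forall>t\<in>torus. X (p ** t) = herm_adj t ** X p ** t)"

text \<open>The function \<open>X\<phi>\<close>.\<close>

definition vderiv :: "vfield \<Rightarrow> (mat3 \<Rightarrow> real) \<Rightarrow> mat3 \<Rightarrow> real" where
  "vderiv X \<phi> p = left_deriv \<phi> p (X p)"

definition lie_bracket :: "vfield \<Rightarrow> vfield \<Rightarrow> vfield" where
  "lie_bracket X Y p = (THE v. v \<in> mm \<and>
     (\<forall>\<phi>. smooth_fun \<phi> \<longrightarrow> left_deriv \<phi> p v = vderiv X (vderiv Y \<phi>) p - vderiv Y (vderiv X \<phi>) p))"

text \<open>The fundamental field of the \<open>SU(3)\<close>-action on \<open>M\<close> generated by \<open>Ad(p)a\<close>. For \<open>a \<in> \<mm>\<close> it is a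
  globally defined vector field with value \<open>a\<close> at \<open>p\<close>. It is used to evaluate tensors at tangent
  vectors; the value does not depend on the extension.\<close>

definition extend :: "mat3 \<Rightarrow> mat3 \<Rightarrow> vfield" where
  "extend p a = (\<lambda>q. mm_part (herm_adj q ** (p ** a ** herm_adj p) ** q))"

section \<open>Levi-Civita and Gauduchon connections\<close>

text \<open>\<open>g\<close> is an inner product on \<open>\<mm>\<close> and \<open>J\<close> an endomorphism of \<open>\<mm>\<close>, both \<open>Ad(T\<^sup>2)\<close>-invariant, i.e.
  an invariant metric and an invariant almost complex structure. The last two clauses say that \<open>D\<close>
  is metric and torsion-free (\<open>D\<^sub>XY - D\<^sub>YX = [X,Y]\<close> as derivations).\<close>

definition levi_civita ::
  "(mat3 \<Rightarrow> mat3 \<Rightarrow> real) \<Rightarrow> (vfield \<Rightarrow> vfield \<Rightarrow> vfield) \<Rightarrow> bool" where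
  "levi_civita g D \<longleftrightarrow>
     (\<forall>X Z. smooth_vfield X \<and> smooth_vfield Z \<longrightarrow> smooth_vfield (D X Z)) \<and>
     (\<forall>X Y Z. smooth_vfield X \<and> smooth_vfield Y \<and> smooth_vfield Z \<longrightarrow> (\<forall>p\<in>SU3.
        D (\<lambda>q. X q + Y q) Z p = D X Z p + D Y Z p \<and>
        D X (\<lambda>q. Y q + Z q) p = D X Y p + D X Z p)) \<and>
     (\<forall>\<phi> X Z. smooth_fun \<phi> \<and> smooth_vfield X \<and> smooth_vfield Z \<longrightarrow> (\<forall>p\<in>SU3.
        D (\<lambda>q. \<phi> q *\<^sub>R X q) Z p = \<phi> p *\<^sub>R D X Z p \<and>
        D X (\<lambda>q. \<phi> q *\<^sub>R Z q) p = vderiv X \<phi> p *\<^sub>R Z p + \<phi> p *\<^sub>R D X Z p)) \<and>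
     (\<forall>X Y Z. smooth_vfield X \<and> smooth_vfield Y \<and> smooth_vfield Z \<longrightarrow> (\<forall>p\<in>SU3.
        vderiv X (\<lambda>q. g (Y q) (Z q)) p = g (D X Y p) (Z p) + g (Y p) (D X Z p))) \<and>
     (\<forall>X Y \<phi>. smooth_vfield X \<and> smooth_vfield Y \<and> smooth_fun \<phi> \<longrightarrow> (\<forall>p\<in>SU3.
        left_deriv \<phi> p (D X Y p - D Y X p) = vderiv X (vderiv Y \<phi>) p - vderiv Y (vderiv X \<phi>) p))"

text \<open>\<open>(D\<^sub>XJ)Z\<close>\<close>

definition cov_J :: "(vfield \<Rightarrow> vfield \<Rightarrow> vfield) \<Rightarrow> (mat3 \<Rightarrow> mat3) \<Rightarrow> vfield \<Rightarrow> vfield \<Rightarrow> vfield" where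
  "cov_J D J X Z p = D X (J \<circ> Z) p - J (D X Z p)"

text \<open>\<open>(D\<^sub>J\<^sub>YJ + J D\<^sub>YJ)X\<close>\<close>

definition cov_J_JJ :: "(vfield \<Rightarrow> vfield \<Rightarrow> vfield) \<Rightarrow> (mat3 \<Rightarrow> mat3) \<Rightarrow> vfield \<Rightarrow> vfield \<Rightarrow> vfield" where
  "cov_J_JJ D J Y X p = cov_J D J (J \<circ> Y) X p + J (cov_J D J Y X p)"

definition gauduchon ::
  "(mat3 \<Rightarrow> mat3 \<Rightarrow> real) \<Rightarrow> (mat3 \<Rightarrow> mat3) \<Rightarrow> (vfield \<Rightarrow> vfield \<Rightarrow> vfield) \<Rightarrow> real \<Rightarrow>
    vfield \<Rightarrow> vfield \<Rightarrow> vfield" where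
  "gauduchon g J D t X Z p = (THE v. v \<in> mm \<and> (\<forall>Y. smooth_vfield Y \<longrightarrow>
     g v (Y p) = g (D X Z p) (Y p) - 1/2 * g (J (cov_J D J X Z p)) (Y p)
       + t/4 * g (cov_J_JJ D J Y X p) (Z p) - t/4 * g (cov_J_JJ D J Z X p) (Y p)))"

section \<open>Curvature and scalar curvatures\<close>

definition curvature ::
  "(mat3 \<Rightarrow> mat3 \<Rightarrow> real) \<Rightarrow> (vfield \<Rightarrow> vfield \<Rightarrow> vfield) \<Rightarrow>
    vfield \<Rightarrow> vfield \<Rightarrow> vfield \<Rightarrow> vfield \<Rightarrow> mat3 \<Rightarrow> real" where
  "curvature g N X Y Z W p =
     - g (N X (N Y Z) p - N Y (N X Z) p - N (lie_bracket X Y) Z p) (W p)"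

definition curvature_at ::
  "(mat3 \<Rightarrow> mat3 \<Rightarrow> real) \<Rightarrow> (vfield \<Rightarrow> vfield \<Rightarrow> vfield) \<Rightarrow> mat3 \<Rightarrow>
    mat3 \<Rightarrow> mat3 \<Rightarrow> mat3 \<Rightarrow> mat3 \<Rightarrow> real" where
  "curvature_at g N p a b c d =
     curvature g N (extend p a) (extend p b) (extend p c) (extend p d) p"

definition orthonormal_frame :: "(mat3 \<Rightarrow> mat3 \<Rightarrow> real) \<Rightarrow> (nat \<Rightarrow> mat3) \<Rightarrow> bool" where
  "orthonormal_frame g e \<longleftrightarrow> (\<forall>i<6. e i \<in> mm) \<and>
     (\<forall>i<6. \<forall>j<6. g (e i) (e j) = (if i = j then 1 else 0))"

definition some_frame :: "(mat3 \<Rightarrow> mat3 \<Rightarrow> real) \<Rightarrow> nat \<Rightarrow> mat3" where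
  "some_frame g = (SOME e. orthonormal_frame g e)"

definition scalar_curvature ::
  "(mat3 \<Rightarrow> mat3 \<Rightarrow> real) \<Rightarrow> (vfield \<Rightarrow> vfield \<Rightarrow> vfield) \<Rightarrow> mat3 \<Rightarrow> real" where
  "scalar_curvature g D p = (\<Sum>i<6. \<Sum>j<6.
     curvature_at g D p (some_frame g i) (some_frame g j) (some_frame g i) (some_frame g j))"

text \<open>\<open>\<mm>\<^sup>\<complex>\<close> consists of the off-diagonal matrices; its conjugation with respect to the real form \<open>\<mm>\<close> is
  \<open>Z \<mapsto> -Z\<^sup>*\<close>, and \<open>Z = mre Z + \<i> mim Z\<close> with \<open>mre Z\<close> and \<open>mim Z\<close> in \<open>\<mm>\<close>.\<close>

definition mm_complex :: "mat3 set" where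
  "mm_complex = {A + cscale \<i> B | A B. A \<in> mm \<and> B \<in> mm}"

definition mconj :: "mat3 \<Rightarrow> mat3" where
  "mconj Z = - herm_adj Z"

definition mre :: "mat3 \<Rightarrow> mat3" where
  "mre Z = cscale (1/2) (Z + mconj Z)"

definition mim :: "mat3 \<Rightarrow> mat3" where
  "mim Z = cscale (1 / (2 * \<i>)) (Z - mconj Z)"

text \<open>Complex linear extension from \<open>\<mm>\<close> to \<open>\<mm>\<^sup>\<complex>\<close>; iterated in each argument below.\<close>

definition cext :: "(mat3 \<Rightarrow> complex) \<Rightarrow> mat3 \<Rightarrow> complex" where
  "cext f Z = f (mre Z) + \<i> * f (mim Z)"

definition cext2 :: "(mat3 \<Rightarrow> mat3 \<Rightarrow> complex) \<Rightarrow> mat3 \<Rightarrow> mat3 \<Rightarrow> complex" where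
  "cext2 f A B = cext (\<lambda>a. cext (f a) B) A"

definition cext3 :: "(mat3 \<Rightarrow> mat3 \<Rightarrow> mat3 \<Rightarrow> complex) \<Rightarrow> mat3 \<Rightarrow> mat3 \<Rightarrow> mat3 \<Rightarrow> complex" where
  "cext3 f A B C = cext (\<lambda>a. cext2 (f a) B C) A"

definition cext4 ::
  "(mat3 \<Rightarrow> mat3 \<Rightarrow> mat3 \<Rightarrow> mat3 \<Rightarrow> complex) \<Rightarrow> mat3 \<Rightarrow> mat3 \<Rightarrow> mat3 \<Rightarrow> mat3 \<Rightarrow> complex" where
  "cext4 f A B C E = cext (\<lambda>a. cext3 (f a) B C E) A"

definition unitary_frame ::
  "(mat3 \<Rightarrow> mat3 \<Rightarrow> real) \<Rightarrow> (mat3 \<Rightarrow> mat3) \<Rightarrow> (nat \<Rightarrow> mat3) \<Rightarrow> bool" where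
  "unitary_frame g J u \<longleftrightarrow> (\<forall>i<3. u i \<in> mm_complex \<and> J (u i) = cscale \<i> (u i)) \<and>
     (\<forall>i<3. \<forall>j<3. cext2 (\<lambda>a b. of_real (g a b)) (u i) (mconj (u j)) = (if i = j then 1 else 0))"

definition some_unitary_frame ::
  "(mat3 \<Rightarrow> mat3 \<Rightarrow> real) \<Rightarrow> (mat3 \<Rightarrow> mat3) \<Rightarrow> nat \<Rightarrow> mat3" where
  "some_unitary_frame g J = (SOME u. unitary_frame g J u)"

text \<open>\<open>s\<^sub>1(t)\<close>, independent of the unitary frame.\<close>

definition hermitian_scalar ::
  "(mat3 \<Rightarrow> mat3 \<Rightarrow> real) \<Rightarrow> (mat3 \<Rightarrow> mat3) \<Rightarrow> (vfield \<Rightarrow> vfield \<Rightarrow> vfield) \<Rightarrow> real \<Rightarrow>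
    mat3 \<Rightarrow> complex" where
  "hermitian_scalar g J D t p = (let u = some_unitary_frame g J in
     \<Sum>i<3. \<Sum>j<3. cext4 (\<lambda>a b c d. of_real (curvature_at g (gauduchon g J D t) p a b c d))
       (mconj (u i)) (u i) (u j) (mconj (u j)))"

text \<open>\<open>s\<^sub>1 = s\<^sub>1(1)\<close>, the Chern scalar curvature.\<close>

definition chern_scalar ::
  "(mat3 \<Rightarrow> mat3 \<Rightarrow> real) \<Rightarrow> (mat3 \<Rightarrow> mat3) \<Rightarrow> (vfield \<Rightarrow> vfield \<Rightarrow> vfield) \<Rightarrow> mat3 \<Rightarrow> complex" where
  "chern_scalar g J D p = hermitian_scalar g J D 1 p"

section \<open>Integrability and the class \<open>W\<^sub>1 \<oplus> W\<^sub>2\<close>\<close>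

definition nijenhuis :: "(mat3 \<Rightarrow> mat3) \<Rightarrow> vfield \<Rightarrow> vfield \<Rightarrow> vfield" where
  "nijenhuis J X Y p = lie_bracket X Y p - lie_bracket (J \<circ> X) (J \<circ> Y) p
     + J (lie_bracket (J \<circ> X) Y p) + J (lie_bracket X (J \<circ> Y) p)"

definition integrable_acs :: "(mat3 \<Rightarrow> mat3) \<Rightarrow> bool" where
  "integrable_acs J \<longleftrightarrow>
     (\<forall>X Y. smooth_vfield X \<and> smooth_vfield Y \<longrightarrow> (\<forall>p\<in>SU3. nijenhuis J X Y p = 0))"

definition fund_form :: "(mat3 \<Rightarrow> mat3 \<Rightarrow> real) \<Rightarrow> (mat3 \<Rightarrow> mat3) \<Rightarrow> mat3 \<Rightarrow> mat3 \<Rightarrow> real" where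
  "fund_form g J a b = g (J a) b"

text \<open>The exterior derivative of a 2-form that is constant in the sense above.\<close>

definition ext_deriv ::
  "(mat3 \<Rightarrow> mat3 \<Rightarrow> real) \<Rightarrow> vfield \<Rightarrow> vfield \<Rightarrow> vfield \<Rightarrow> mat3 \<Rightarrow> real" where
  "ext_deriv F X Y Z p =
     vderiv X (\<lambda>q. F (Y q) (Z q)) p + vderiv Y (\<lambda>q. F (Z q) (X q)) p + vderiv Z (\<lambda>q. F (X q) (Y q)) p
     - F (lie_bracket X Y p) (Z p) - F (lie_bracket Y Z p) (X p) - F (lie_bracket Z X p) (Y p)"

definition dF_at ::
  "(mat3 \<Rightarrow> mat3 \<Rightarrow> real) \<Rightarrow> (mat3 \<Rightarrow> mat3) \<Rightarrow> mat3 \<Rightarrow> mat3 \<Rightarrow> mat3 \<Rightarrow> mat3 \<Rightarrow> complex" where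
  "dF_at g J p a b c =
     of_real (ext_deriv (fund_form g J) (extend p a) (extend p b) (extend p c) p)"

text \<open>The projections of \<open>a \<in> \<mm>\<close> to \<open>T\<^sup>1\<^sup>,\<^sup>0\<close> (\<open>True\<close>) and \<open>T\<^sup>0\<^sup>,\<^sup>1\<close> (\<open>False\<close>).\<close>

definition type_proj :: "(mat3 \<Rightarrow> mat3) \<Rightarrow> bool \<Rightarrow> mat3 \<Rightarrow> mat3" where
  "type_proj J s a = cscale (1/2) (a + cscale (if s then - \<i> else \<i>) (J a))"

text \<open>The \<open>(2,1) + (1,2)\<close> part of a 3-form.\<close>

definition plus_part ::
  "(mat3 \<Rightarrow> mat3) \<Rightarrow> (mat3 \<Rightarrow> mat3 \<Rightarrow> mat3 \<Rightarrow> complex) \<Rightarrow> mat3 \<Rightarrow> mat3 \<Rightarrow> mat3 \<Rightarrow> complex" where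
  "plus_part J \<psi> a b c = (\<Sum>(r, s, t) \<in> {(r, s, t). \<not> (r = s \<and> s = t)}.
     cext3 \<psi> (type_proj J r a) (type_proj J s b) (type_proj J t c))"

text \<open>Vanishing of the contraction with \<open>F\<close>.\<close>

definition primitive_form ::
  "(mat3 \<Rightarrow> mat3 \<Rightarrow> real) \<Rightarrow> (mat3 \<Rightarrow> mat3) \<Rightarrow> (mat3 \<Rightarrow> mat3 \<Rightarrow> mat3 \<Rightarrow> complex) \<Rightarrow> bool" where
  "primitive_form g J \<psi> \<longleftrightarrow>
     (\<forall>c\<in>mm. (\<Sum>i<6. \<psi> (some_frame g i) (J (some_frame g i)) c) = 0)"

text \<open>The Lefschetz decomposition \<open>\<psi> = \<psi>\<^sub>0 + \<beta> \<and> F\<close> with \<open>\<psi>\<^sub>0\<close> primitive; it is unique.\<close>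

definition is_primitive_part ::
  "(mat3 \<Rightarrow> mat3 \<Rightarrow> real) \<Rightarrow> (mat3 \<Rightarrow> mat3) \<Rightarrow> (mat3 \<Rightarrow> mat3 \<Rightarrow> mat3 \<Rightarrow> complex) \<Rightarrow>
    (mat3 \<Rightarrow> mat3 \<Rightarrow> mat3 \<Rightarrow> complex) \<Rightarrow> bool" where
  "is_primitive_part g J \<psi> \<psi>0 \<longleftrightarrow> primitive_form g J \<psi>0 \<and>
     (\<exists>\<beta> :: mat3 \<Rightarrow> complex. linear \<beta> \<and> (\<forall>a\<in>mm. \<forall>b\<in>mm. \<forall>c\<in>mm.
        \<psi> a b c = \<psi>0 a b c + \<beta> a * of_real (fund_form g J b c)
          + \<beta> b * of_real (fund_form g J c a) + \<beta> c * of_real (fund_form g J a b)))"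

text \<open>\<open>(D\<^sub>XF)(Y,Z)\<close>, \<open>\<delta>F = - \<Sum>\<^sub>i (D\<^sub>e\<^sub>iF)(e\<^sub>i, \<cdot>)\<close>, and \<open>\<alpha>\<^sub>F = J\<delta>F\<close> with \<open>(J\<alpha>)(a) = - \<alpha>(Ja)\<close>.\<close>

definition cov_form ::
  "(vfield \<Rightarrow> vfield \<Rightarrow> vfield) \<Rightarrow> (mat3 \<Rightarrow> mat3 \<Rightarrow> real) \<Rightarrow> vfield \<Rightarrow> vfield \<Rightarrow> vfield \<Rightarrow>
    mat3 \<Rightarrow> real" where
  "cov_form D F X Y Z p =
     vderiv X (\<lambda>q. F (Y q) (Z q)) p - F (D X Y p) (Z p) - F (Y p) (D X Z p)"

definition codiff_F ::
  "(mat3 \<Rightarrow> mat3 \<Rightarrow> real) \<Rightarrow> (mat3 \<Rightarrow> mat3) \<Rightarrow> (vfield \<Rightarrow> vfield \<Rightarrow> vfield) \<Rightarrow> mat3 \<Rightarrow>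
    mat3 \<Rightarrow> real" where
  "codiff_F g J D p a = - (\<Sum>i<6. cov_form D (fund_form g J)
     (extend p (some_frame g i)) (extend p (some_frame g i)) (extend p a) p)"

definition lee_form ::
  "(mat3 \<Rightarrow> mat3 \<Rightarrow> real) \<Rightarrow> (mat3 \<Rightarrow> mat3) \<Rightarrow> (vfield \<Rightarrow> vfield \<Rightarrow> vfield) \<Rightarrow> mat3 \<Rightarrow>
    mat3 \<Rightarrow> real" where
  "lee_form g J D p a = - codiff_F g J D p (J a)"

definition in_W1_W2 ::
  "(mat3 \<Rightarrow> mat3 \<Rightarrow> real) \<Rightarrow> (mat3 \<Rightarrow> mat3) \<Rightarrow> (vfield \<Rightarrow> vfield \<Rightarrow> vfield) \<Rightarrow> bool" where
  "in_W1_W2 g J D \<longleftrightarrow> (\<forall>p\<in>SU3.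
     is_primitive_part g J (plus_part J (dF_at g J p)) (\<lambda>_ _ _. 0) \<and>
     (\<forall>a\<in>mm. lee_form g J D p a = 0))"

end

theory Submission
  imports Defs
begin

text \<open>
  Write the Levi-Civita connection in the trivialisation by \<open>\<mm>\<close> as the left-invariant derivative plus
  Nomizu's bilinear map \<open>\<Lambda>\<close>, which is determined by Koszul's argument. For a non-integrable \<open>J\<close> either
  \<open>\<alpha>\<^sub>1\<^sub>2, \<alpha>\<^sub>2\<^sub>3, \<alpha>\<^sub>3\<^sub>1\<close> or their negatives are the roots of type \<open>(1,0)\<close>, and then \<open>\<Lambda>\<close> is
  \<open>J\<close>-antilinear in both arguments. Hence the Chern connection is the canonical connection, whose
  curvature \<open>R(X,Y)\<close> is the action of the \<open>\<tt>\<close>-part of \<open>[X,Y]\<close>. Its trace on \<open>T\<^sup>1\<^sup>,\<^sup>0\<close> is the sum of the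
  three roots, which is zero, so \<open>s\<^sub>1 = 0\<close>. The same antilinearity makes \<open>dF\<close> of type \<open>(3,0) + (0,3)\<close>, and the
  Lee form vanishes because for \<open>X \<in> \<uu>\<^sub>i\<^sub>j\<close> the image of \<open>\<Lambda>(X)\<close> is orthogonal to \<open>\<uu>\<^sub>i\<^sub>j\<close>; so
  \<open>(g,J)\<close> is in \<open>W\<^sub>1 \<oplus> W\<^sub>2\<close> for every metric. The condition \<open>2s\<^sub>1 - s = 0\<close> therefore is \<open>s = 0\<close>, i.e.
  \<open>x\<^sup>2 + y\<^sup>2 + z\<^sup>2 = 6(xy + yz + zx)\<close>, a quadratic equation for \<open>z\<close> whose smaller root is positive
  exactly when \<open>x\<^sup>2 - 6xy + y\<^sup>2 > 0\<close>.
\<close>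

section \<open>Entrywise matrix computations and linearity\<close>

lemma mat3_eqI: "(\<And>i j. (A::mat3) $ i $ j = B $ i $ j) \<Longrightarrow> A = B"
  by (simp add: vec_eq_iff)

lemma matrix_mult_nth:
  "((A::mat3) ** B) $ i $ k = A $ i $ 1 * B $ 1 $ k + A $ i $ 2 * B $ 2 $ k + A $ i $ 3 * B $ 3 $ k"
  by (simp add: matrix_matrix_mult_def sum_3)

lemma comm_nth: "comm A B $ i $ k = (A ** B) $ i $ k - (B ** A) $ i $ k"
  by (simp add: comm_def)

lemma herm_adj_nth [simp]: "herm_adj A $ i $ j = cnj (A $ j $ i)"
  by (simp add: herm_adj_def)

lemma cscale_nth [simp]: "cscale c A $ i $ j = c * A $ i $ j"
  by (simp add: cscale_def)

lemma inv_acs_nth [simp]: "inv_acs \<epsilon> A $ i $ j = \<i> * of_real (\<epsilon> i j) * A $ i $ j"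
  by (simp add: inv_acs_def)

lemma mm_part_nth [simp]: "mm_part A $ i $ j = (if i = j then 0 else A $ i $ j)"
  using exhaust_3[of i] exhaust_3[of j]
  by (elim disjE) (simp_all add: mm_part_def uu_part_def)

lemma herm_adj_mult: "herm_adj (A ** B) = herm_adj B ** herm_adj A"
  by (rule mat3_eqI) (simp add: matrix_mult_nth algebra_simps)

lemma herm_adj_herm_adj [simp]: "herm_adj (herm_adj A) = A"
  by (rule mat3_eqI) simp

lemma herm_adj_add: "herm_adj (A + B) = herm_adj A + herm_adj B"
  by (rule mat3_eqI) simp

lemma skew_nth:
  assumes "herm_adj X = - X" shows "X $ j $ i = - cnj (X $ i $ j)"
proof -
  have "herm_adj X $ j $ i = - X $ j $ i" using assms by simp
  then show ?thesis by (metis herm_adj_nth minus_minus)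
qed

lemma skew_cnj:
  assumes "herm_adj X = - X" shows "cnj (X $ i $ j) = - X $ j $ i"
  using skew_nth[OF assms, of j i] by simp

lemma linear_herm_adj: "linear herm_adj"
  by (rule linearI; rule mat3_eqI) (simp_all add: algebra_simps)

lemma linear_mm_part: "linear mm_part"
  by (rule linearI; rule mat3_eqI) (simp_all add: algebra_simps)

lemma linear_inv_acs: "linear (inv_acs \<epsilon>)"
  by (rule linearI; rule mat3_eqI) (simp_all add: algebra_simps)

lemma bilinear_intro:
  assumes "\<And>a b c. f (a + b) c = f a c + f b c" "\<And>a b c. f c (a + b) = f c a + f c b"
    "\<And>r a b. f (r *\<^sub>R a) b = r *\<^sub>R f a b" "\<And>r a b. f a (r *\<^sub>R b) = r *\<^sub>R f a b"
  shows "bilinear f"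
  unfolding bilinear_def using assms by (auto intro!: linearI)

lemma bounded_bilinear_matrix_mult: "bounded_bilinear ((**) :: mat3 \<Rightarrow> mat3 \<Rightarrow> mat3)"
  unfolding bilinear_conv_bounded_bilinear[symmetric]
  by (rule bilinear_intro; rule mat3_eqI) (simp_all add: matrix_mult_nth algebra_simps)

subsection \<open>The isotropy module\<close>

lemma comm_diagonal_nth:
  assumes "diagonal H"
  shows "comm H X $ k $ l = (H $ k $ k - H $ l $ l) * X $ k $ l"
proof -
  have H: "H $ 1 $ 2 = 0" "H $ 1 $ 3 = 0" "H $ 2 $ 1 = 0" "H $ 2 $ 3 = 0" "H $ 3 $ 1 = 0" "H $ 3 $ 2 = 0"
    using assms by (simp_all add: diagonal_def)
  from exhaust_3[of k] exhaust_3[of l] show ?thesis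
    by (elim disjE) (simp_all add: comm_nth matrix_mult_nth H left_diff_distrib)
qed

lemma root_space_nth_zero:
  assumes X: "X \<in> root_space i j" and "i \<noteq> j" "(k, l) \<noteq> (i, j)"
  shows "X $ k $ l = 0"
proof -
  \<comment> \<open>The test element diag(1, 10, -11) is traceless and its six differences of
    distinct entries are pairwise different and nonzero, so its commutator alone isolates a single
    entry of \<open>X\<close>.\<close>
  define h :: "3 \<Rightarrow> complex" where "h k = (if k = 1 then 1 else if k = 2 then 10 else - 11)" for k
  define H :: mat3 where "H = (\<chi> k l. if k = l then h k else 0)"
  have Hd: "H $ i $ i = h i" for i by (simp add: H_def)
  have "diagonal H" "trace H = 0"
    by (simp_all add: H_def diagonal_def trace_def sum_3 h_def)
  then have "comm H X = cscale (H $ i $ i - H $ j $ j) X"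
    using X by (simp add: root_space_def)
  then have "comm H X $ k $ l = cscale (H $ i $ i - H $ j $ j) X $ k $ l"
    by simp
  moreover have "comm H X $ k $ l = (h k - h l) * X $ k $ l"
    unfolding comm_diagonal_nth[OF \<open>diagonal H\<close>] by (simp add: Hd)
  ultimately have "(h k - h l - (h i - h j)) * X $ k $ l = 0"
    by (simp add: Hd algebra_simps)
  moreover have "h k - h l - (h i - h j) \<noteq> 0"
    using assms(2,3) exhaust_3[of k] exhaust_3[of l] exhaust_3[of i] exhaust_3[of j]
    by (elim disjE) (simp_all add: h_def)
  ultimately show ?thesis by simp
qed

lemma unit_mat_root_space: "i \<noteq> j \<Longrightarrow> cscale c (unit_mat i j) \<in> root_space i j"
  by (auto simp: root_space_def trace_def unit_mat_def intro!: mat3_eqI sum.neutral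
      simp: comm_diagonal_nth)

text \<open>Both root spaces are lines spanned by elementary matrices, so only the support and the
  skew-Hermitian symmetry remain.\<close>

lemma uu_iff:
  assumes "i \<noteq> j"
  shows "X \<in> uu i j \<longleftrightarrow>
    herm_adj X = - X \<and> (\<forall>k l. (k, l) \<noteq> (i, j) \<and> (k, l) \<noteq> (j, i) \<longrightarrow> X $ k $ l = 0)"
    (is "_ \<longleftrightarrow> _ \<and> ?Z")
proof
  assume "X \<in> uu i j"
  then obtain A B where X: "X = A + B" "A \<in> root_space i j" "B \<in> root_space j i" and s: "X \<in> su3"
    by (auto simp: uu_def)
  have "?Z"
    unfolding X(1) using root_space_nth_zero[OF X(2)] root_space_nth_zero[OF X(3)] assms by simp
  then show "herm_adj X = - X \<and> ?Z" using s by (simp add: su3_def)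
next
  assume R: "herm_adj X = - X \<and> ?Z"
  have eq: "X = cscale (X $ i $ j) (unit_mat i j) + cscale (X $ j $ i) (unit_mat j i)"
    using R assms by (intro mat3_eqI) (auto simp: unit_mat_def)
  have "X $ k $ k = 0" for k using R assms by auto
  then have "trace X = 0" by (simp add: trace_def)
  then have "X \<in> su3" using R by (simp add: su3_def)
  with eq assms show "X \<in> uu i j"
    unfolding uu_def by (blast intro: unit_mat_root_space)
qed

lemma mm_iff: "X \<in> mm \<longleftrightarrow> herm_adj X = - X \<and> (\<forall>i. X $ i $ i = 0)"
proof
  assume "X \<in> mm"
  then obtain a b c where X: "X = a + b + c" and abc: "a \<in> uu 1 2" "b \<in> uu 2 3" "c \<in> uu 1 3"
    by (auto simp: mm_def)
  have "a $ i $ i = 0" "b $ i $ i = 0" "c $ i $ i = 0" for i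
    using abc by (auto simp: uu_iff)
  then show "herm_adj X = - X \<and> (\<forall>i. X $ i $ i = 0)"
    using abc by (simp add: uu_iff X herm_adj_add)
next
  assume R: "herm_adj X = - X \<and> (\<forall>i. X $ i $ i = 0)"
  have eq: "X = uu_part 1 2 X + uu_part 2 3 X + uu_part 1 3 X"
    unfolding mm_part_def[symmetric] using R by (intro mat3_eqI) simp
  have "uu_part i j X \<in> uu i j" if "i \<noteq> j" for i j
  proof -
    have "herm_adj (uu_part i j X) = - uu_part i j X"
      by (rule mat3_eqI) (use R in \<open>auto simp: uu_part_def skew_cnj\<close>)
    then show ?thesis using that by (simp add: uu_iff uu_part_def)
  qed
  then have "uu_part 1 2 X \<in> uu 1 2" "uu_part 2 3 X \<in> uu 2 3" "uu_part 1 3 X \<in> uu 1 3"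
    by simp_all
  with eq show "X \<in> mm" unfolding mm_def by blast
qed

lemma mm_subset_su3: "mm \<subseteq> su3"
  by (auto simp: mm_iff su3_def trace_def)

lemma subspace_mm: "subspace mm"
  by (auto simp: subspace_def mm_iff herm_adj_add linear_scale[OF linear_herm_adj]
      linear_0[OF linear_herm_adj])

lemma subspace_su3: "subspace su3"
  by (auto simp: subspace_def su3_def herm_adj_add linear_scale[OF linear_herm_adj]
      linear_0[OF linear_herm_adj] trace_def sum.distrib simp flip: scaleR_sum_right)

lemma mm_part_mm [simp]: "X \<in> mm \<Longrightarrow> mm_part X = X"
  by (intro mat3_eqI) (simp add: mm_iff)

lemma mm_part_in_mm:
  assumes "herm_adj X = - X" shows "mm_part X \<in> mm"
proof -
  have "herm_adj (mm_part X) = - mm_part X"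
    by (rule mat3_eqI) (simp add: skew_cnj[OF assms])
  then show ?thesis by (simp add: mm_iff)
qed

lemma comm_su3: "a \<in> su3 \<Longrightarrow> b \<in> su3 \<Longrightarrow> herm_adj (comm a b) = - comm a b"
proof -
  assume "a \<in> su3" "b \<in> su3"
  then have "herm_adj a = - a" "herm_adj b = - b" by (auto simp: su3_def)
  moreover have "(- A) ** (- B) = A ** B" for A B :: mat3
    by (rule mat3_eqI) (simp add: matrix_mult_nth)
  ultimately show ?thesis
    by (simp add: comm_def linear_diff[OF linear_herm_adj] herm_adj_mult)
qed

lemma mm_comm: "a \<in> mm \<Longrightarrow> b \<in> mm \<Longrightarrow> mm_part (comm a b) \<in> mm"
  using comm_su3 mm_subset_su3 by (auto intro!: mm_part_in_mm)

text \<open>Complex coordinates on \<open>mm\<close>: skew symmetry determines an element by its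
  entries above the diagonal. The arguments come in the order 12, 23, 13 of the metric parameters,
  so the third one sits in the corner.\<close>

definition mk :: "complex \<Rightarrow> complex \<Rightarrow> complex \<Rightarrow> mat3" where
  "mk \<alpha> \<beta> \<gamma> = vector [vector [0, \<alpha>, \<gamma>], vector [- cnj \<alpha>, 0, \<beta>], vector [- cnj \<gamma>, - cnj \<beta>, 0]]"

lemma mk_nth [simp]:
  "mk \<alpha> \<beta> \<gamma> $ 1 $ 1 = 0" "mk \<alpha> \<beta> \<gamma> $ 1 $ 2 = \<alpha>" "mk \<alpha> \<beta> \<gamma> $ 1 $ 3 = \<gamma>"
  "mk \<alpha> \<beta> \<gamma> $ 2 $ 1 = - cnj \<alpha>" "mk \<alpha> \<beta> \<gamma> $ 2 $ 2 = 0" "mk \<alpha> \<beta> \<gamma> $ 2 $ 3 = \<beta>"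
  "mk \<alpha> \<beta> \<gamma> $ 3 $ 1 = - cnj \<gamma>" "mk \<alpha> \<beta> \<gamma> $ 3 $ 2 = - cnj \<beta>" "mk \<alpha> \<beta> \<gamma> $ 3 $ 3 = 0"
  by (simp_all add: mk_def)

lemma mk_in_mm [simp]: "mk \<alpha> \<beta> \<gamma> \<in> mm"
  by (simp add: mm_iff forall_3 vec_eq_iff)

lemma mm_eq_mk:
  assumes "X \<in> mm" shows "X = mk (X $ 1 $ 2) (X $ 2 $ 3) (X $ 1 $ 3)"
proof -
  have X: "herm_adj X = - X" "X $ 1 $ 1 = 0" "X $ 2 $ 2 = 0" "X $ 3 $ 3 = 0"
    using assms by (auto simp: mm_iff)
  show ?thesis
    using X(2-4) skew_nth[OF X(1), of 2 1] skew_nth[OF X(1), of 3 2] skew_nth[OF X(1), of 3 1]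
    by (simp add: vec_eq_iff forall_3)
qed

lemma mm_cases:
  assumes "X \<in> mm" obtains \<alpha> \<beta> \<gamma> where "X = mk \<alpha> \<beta> \<gamma>"
  using mm_eq_mk[OF assms] by blast

subsection \<open>The group and its tangent vectors\<close>

lemma SU3_unitary: "p \<in> SU3 \<Longrightarrow> p ** herm_adj p = mat 1" "p \<in> SU3 \<Longrightarrow> herm_adj p ** p = mat 1"
  using matrix_left_right_inverse[of p "herm_adj p"] by (auto simp: SU3_def)

lemma SU3_mult: "p \<in> SU3 \<Longrightarrow> q \<in> SU3 \<Longrightarrow> p ** q \<in> SU3"
proof -
  assume pq: "p \<in> SU3" "q \<in> SU3"
  have "(p ** q) ** herm_adj (p ** q) = p ** (q ** herm_adj q) ** herm_adj p"
    by (simp add: herm_adj_mult matrix_mul_assoc)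
  then show ?thesis using pq by (simp add: SU3_def det_mul)
qed

lemma mat_1_in_SU3: "mat 1 \<in> SU3"
proof -
  have "herm_adj (mat 1) = mat 1" by (rule mat3_eqI) (simp add: mat_def)
  then show ?thesis by (simp add: SU3_def)
qed

text \<open>A real basis of su(3) whose members all have eigenvalues 0, i and -i, which gives their
  exponentials a closed form.\<close>

definition su3_gens :: "mat3 set" where
  "su3_gens = {mk 1 0 0, mk \<i> 0 0, mk 0 1 0, mk 0 \<i> 0, mk 0 0 1, mk 0 0 \<i>,
     cscale \<i> (unit_mat 1 1 - unit_mat 3 3), cscale \<i> (unit_mat 2 2 - unit_mat 3 3)}"

lemma su3_span_gens: "su3 \<subseteq> span su3_gens"
proof
  fix v assume v: "v \<in> su3"
  have h: "v $ j $ i = - cnj (v $ i $ j)" for i j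
  using v by (intro skew_nth) (simp add: su3_def)
  have d: "Re (v $ i $ i) = 0" for i using arg_cong[OF h[of i i], of Re] by simp
  have t: "v $ 3 $ 3 = - v $ 1 $ 1 - v $ 2 $ 2"
    using v by (simp add: su3_def trace_def sum_3 algebra_simps add_eq_0_iff)
  have "v = Re (v $ 1 $ 2) *\<^sub>R mk 1 0 0 + Im (v $ 1 $ 2) *\<^sub>R mk \<i> 0 0
      + Re (v $ 2 $ 3) *\<^sub>R mk 0 1 0 + Im (v $ 2 $ 3) *\<^sub>R mk 0 \<i> 0
      + Re (v $ 1 $ 3) *\<^sub>R mk 0 0 1 + Im (v $ 1 $ 3) *\<^sub>R mk 0 0 \<i>
      + Im (v $ 1 $ 1) *\<^sub>R cscale \<i> (unit_mat 1 1 - unit_mat 3 3)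
      + Im (v $ 2 $ 2) *\<^sub>R cscale \<i> (unit_mat 2 2 - unit_mat 3 3)"
    using h[of 1 2] h[of 2 3] h[of 1 3] d[of 1] d[of 2] t
    by (simp add: vec_eq_iff forall_3 unit_mat_def complex_eq_iff)
  also have "\<dots> \<in> span su3_gens"
    by (intro span_add span_scale span_base) (simp_all add: su3_gens_def)
  finally show "v \<in> span su3_gens" .
qed

text \<open>All generators satisfy \<open>v\<^sup>3 = -v\<close>, so this is \<open>exp (tv)\<close>.\<close>

definition gen_curve :: "mat3 \<Rightarrow> real \<Rightarrow> mat3" where
  "gen_curve v t = mat 1 + sin t *\<^sub>R v + (1 - cos t) *\<^sub>R (v ** v)"

lemma gen_curve_SU3:
  assumes "v \<in> su3_gens" shows "gen_curve v t \<in> SU3"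
proof -
  \<comment> \<open>The Pythagorean identity over the complex numbers, oriented to eliminate the
    sine; \<open>sc'\<close> is the same rule inside a right-associated product.\<close>
  have sc: "complex_of_real (sin t) * of_real (sin t) = 1 - of_real (cos t) * of_real (cos t)"
    using sin_cos_squared_add3[of t]
    by (metis add_diff_cancel_left' of_real_1 of_real_diff of_real_mult)
  have sc': "complex_of_real (sin t) * (of_real (sin t) * a) = a - of_real (cos t) * (of_real (cos t) * a)" for a
    unfolding mult.assoc[symmetric, of "complex_of_real (sin t)"] sc
    by (simp only: left_diff_distrib mult_1 mult.assoc)
  show ?thesis
    using assms unfolding su3_gens_def insert_iff empty_iff
    by (elim disjE FalseE; hypsubst; simp add: gen_curve_def SU3_def vec_eq_iff forall_3 det_3
        matrix_mult_nth mat_def unit_mat_def scaleR_conv_of_real[where 'a=complex]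
        algebra_simps sc sc')
qed

lemma gen_curve_deriv: "(gen_curve v has_derivative (\<lambda>t. t *\<^sub>R v)) (at 0)"
  unfolding gen_curve_def by (auto intro!: derivative_eq_intros simp: fun_eq_iff)

text \<open>For a generator \<open>v\<close>, the curve \<open>p ** gen_curve v t\<close> stays in
  SU(3) and has velocity \<open>p ** v\<close>. Composing \<open>f\<close> with it gives a function
  of a real variable, whose derivative is unique; linearity extends this to all of su(3).\<close>

lemma tangent_deriv_unique:
  fixes f :: "mat3 \<Rightarrow> 'a::real_normed_vector"
  assumes f: "(f has_derivative f1) (at p within SU3)" "(f has_derivative f2) (at p within SU3)"
    and p: "p \<in> SU3" and v: "v \<in> su3"
  shows "f1 (p ** v) = f2 (p ** v)"
proof -
  interpret mm: bounded_bilinear "(**) :: mat3 \<Rightarrow> mat3 \<Rightarrow> mat3" by (rule bounded_bilinear_matrix_mult)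
  have lin: "linear f1" "linear f2" using f by (auto dest: has_derivative_linear)
  have gen: "f1 (p ** v) = f2 (p ** v)" if v: "v \<in> su3_gens" for v
  proof -
    have c: "((\<lambda>t. p ** gen_curve v t) has_derivative (\<lambda>t. p ** (t *\<^sub>R v))) (at 0)"
      by (rule bounded_linear.has_derivative[OF mm.bounded_linear_right gen_curve_deriv])
    have 0: "p ** gen_curve v 0 = p" by (simp add: gen_curve_def)
    have sub: "range (\<lambda>t. p ** gen_curve v t) \<subseteq> SU3"
      using gen_curve_SU3[OF v] p by (auto intro: SU3_mult)
    have *: "((\<lambda>t. f (p ** gen_curve v t)) has_derivative (\<lambda>t. f' (p ** (t *\<^sub>R v)))) (at 0)"
      if "(f has_derivative f') (at p within SU3)" for f'
      using has_derivative_in_compose[OF c, of f f'] has_derivative_subset[OF that sub] 0 by simp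
    have "(\<lambda>t. f1 (p ** (t *\<^sub>R v))) = (\<lambda>t. f2 (p ** (t *\<^sub>R v)))"
      using has_derivative_unique[OF *[OF f(1)] *[OF f(2)]] .
    from fun_cong[OF this, of 1] show ?thesis by simp
  qed
  have "v \<in> span su3_gens" using v su3_span_gens by auto
  then show ?thesis
  proof (induction rule: span_induct_alt)
    case base
    show ?case using lin by (simp add: mm.zero_right linear_0)
  next
    case (step c x y)
    then show ?case using lin gen
      by (simp add: mm.add_right mm.scaleR_right linear_add linear_scale)
  qed
qed

text \<open>\<open>frechet_derivative\<close> selects some derivative. On tangent vectors all
  choices agree, so left derivatives can be computed by the usual rules.\<close>

lemma left_deriv_eq:
  assumes "(f has_derivative f') (at p within SU3)" "p \<in> SU3" "v \<in> su3"
  shows "left_deriv f p v = f' (p ** v)"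
  unfolding left_deriv_def
  using tangent_deriv_unique[OF _ assms(1) assms(2,3)] assms(1)
  by (meson differentiable_def frechet_derivative_works)


subsection \<open>Calculus on the group\<close>

lemma left_deriv_cong:
  assumes "\<And>q. q \<in> SU3 \<Longrightarrow> f q = h q" "p \<in> SU3"
  shows "left_deriv f p = left_deriv h p"
proof -
  have "(f has_derivative f') (at p within SU3) \<longleftrightarrow> (h has_derivative f') (at p within SU3)" for f'
    using assms by (auto intro: has_derivative_transform[rotated 2])
  then show ?thesis by (simp add: left_deriv_def frechet_derivative_def fun_eq_iff)
qed

lemma C_k_cong:
  assumes "\<And>q. q \<in> SU3 \<Longrightarrow> f q = h q" "C_k_on_SU3 k f"
  shows "C_k_on_SU3 k h"
  using assms
proof (induction k arbitrary: f h)
  case 0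
  then show ?case by (simp cong: continuous_on_cong)
next
  case (Suc k)
  have "h differentiable (at p within SU3)" if p: "p \<in> SU3" for p
  proof -
    from Suc.prems(2) p obtain D where "(f has_derivative D) (at p within SU3)"
      by (auto simp: differentiable_def)
    then have "(h has_derivative D) (at p within SU3)"
      by (rule has_derivative_transform[rotated 2]) (use Suc.prems(1) p in auto)
    then show ?thesis by (auto simp: differentiable_def)
  qed
  moreover have "C_k_on_SU3 k (\<lambda>p. left_deriv h p v)" if "v \<in> su3" for v
    by (rule Suc.IH[of "\<lambda>p. left_deriv f p v"])
      (use Suc.prems that left_deriv_cong[of f h] in auto)
  ultimately show ?case by simp
qed

lemma smooth_cong: "(\<And>q. q \<in> SU3 \<Longrightarrow> f q = h q) \<Longrightarrow> smooth_SU3 f \<Longrightarrow> smooth_SU3 h"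
  using C_k_cong unfolding smooth_SU3_def by blast

lemma smooth_differentiable: "smooth_SU3 f \<Longrightarrow> p \<in> SU3 \<Longrightarrow> f differentiable (at p within SU3)"
  unfolding smooth_SU3_def by (metis C_k_on_SU3.simps(2))

lemma smooth_left_deriv: "smooth_SU3 f \<Longrightarrow> v \<in> su3 \<Longrightarrow> smooth_SU3 (\<lambda>p. left_deriv f p v)"
  unfolding smooth_SU3_def by (metis C_k_on_SU3.simps(2))

lemma left_deriv_works:
  assumes "f differentiable (at p within SU3)"
  shows "(f has_derivative frechet_derivative f (at p within SU3)) (at p within SU3)"
  using assms by (simp add: frechet_derivative_works)

lemma left_deriv_compose_linear:
  assumes "bounded_linear L" "f differentiable (at p within SU3)" "p \<in> SU3" "v \<in> su3"
  shows "left_deriv (\<lambda>q. L (f q)) p v = L (left_deriv f p v)"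
  using left_deriv_eq[OF bounded_linear.has_derivative[OF assms(1) left_deriv_works[OF assms(2)]] assms(3,4)]
  by (simp add: left_deriv_def)

lemma left_deriv_bilinear:
  assumes "bounded_bilinear B" "f differentiable (at p within SU3)" "h differentiable (at p within SU3)"
    "p \<in> SU3" "v \<in> su3"
  shows "left_deriv (\<lambda>q. B (f q) (h q)) p v = B (f p) (left_deriv h p v) + B (left_deriv f p v) (h p)"
  using left_deriv_eq[OF bounded_bilinear.FDERIV[OF assms(1) left_deriv_works[OF assms(2)]
        left_deriv_works[OF assms(3)]] assms(4,5)]
  by (simp add: left_deriv_def)

lemma left_deriv_add:
  assumes "f differentiable (at p within SU3)" "h differentiable (at p within SU3)"
    "p \<in> SU3" "v \<in> su3"
  shows "left_deriv (\<lambda>q. f q + h q) p v = left_deriv f p v + left_deriv h p v"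
  using left_deriv_eq[OF has_derivative_add[OF left_deriv_works[OF assms(1)]
        left_deriv_works[OF assms(2)]] assms(3,4)]
  by (simp add: left_deriv_def)

lemma left_deriv_of_linear:
  assumes "bounded_linear L" "p \<in> SU3" "v \<in> su3"
  shows "left_deriv L p v = L (p ** v)"
  by (rule left_deriv_eq[OF bounded_linear_imp_has_derivative[OF assms(1)] assms(2,3)])

lemma smooth_compose_linear:
  assumes "bounded_linear L" "smooth_SU3 f"
  shows "smooth_SU3 (\<lambda>q. L (f q))"
proof -
  have "C_k_on_SU3 k (\<lambda>q. L (f q))" if "smooth_SU3 f" for k and f :: "mat3 \<Rightarrow> 'a"
    using that
  proof (induction k arbitrary: f)
    case 0
    then have "continuous_on SU3 f" unfolding smooth_SU3_def by (metis C_k_on_SU3.simps(1))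
    then show ?case by (simp add: bounded_linear.continuous_on[OF assms(1)])
  next
    case (Suc k)
    have "(\<lambda>q. L (f q)) differentiable (at p within SU3)" if "p \<in> SU3" for p
      using bounded_linear.has_derivative[OF assms(1) left_deriv_works[OF smooth_differentiable[OF Suc.prems that]]]
      by (auto simp: differentiable_def)
    moreover have "C_k_on_SU3 k (\<lambda>p. left_deriv (\<lambda>q. L (f q)) p v)" if v: "v \<in> su3" for v
      by (rule C_k_cong[OF _ Suc.IH[OF smooth_left_deriv[OF Suc.prems v]]])
        (simp add: left_deriv_compose_linear[OF assms(1) smooth_differentiable[OF Suc.prems]] v)
    ultimately show ?case by simp
  qed
  then show ?thesis using assms(2) by (simp add: smooth_SU3_def)
qed

lemma C_k_add:
  assumes "C_k_on_SU3 k f" "C_k_on_SU3 k h"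
  shows "C_k_on_SU3 k (\<lambda>q. f q + h q)"
  using assms
proof (induction k arbitrary: f h)
  case 0
  then show ?case by (simp add: continuous_on_add)
next
  case (Suc k)
  then have d: "f differentiable (at p within SU3)" "h differentiable (at p within SU3)" if "p \<in> SU3" for p
    using that by auto
  have "C_k_on_SU3 k (\<lambda>p. left_deriv (\<lambda>q. f q + h q) p v)" if v: "v \<in> su3" for v
    by (rule C_k_cong[OF _ Suc.IH[of "\<lambda>p. left_deriv f p v" "\<lambda>p. left_deriv h p v"]])
      (use Suc.prems v in \<open>simp_all add: left_deriv_add[OF d]\<close>)
  then show ?case using d by simp
qed

lemma smooth_add: "smooth_SU3 f \<Longrightarrow> smooth_SU3 h \<Longrightarrow> smooth_SU3 (\<lambda>q. f q + h q)"
  by (simp add: smooth_SU3_def C_k_add)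

text \<open>Induction on the order for all smooth factors at once: the product rule returns a sum of
  two products of the same kind.\<close>

lemma smooth_bilinear:
  assumes B: "bounded_bilinear B" and "smooth_SU3 f" "smooth_SU3 h"
  shows "smooth_SU3 (\<lambda>q. B (f q) (h q))"
proof -
  have "C_k_on_SU3 k (\<lambda>q. B (f q) (h q))" if "smooth_SU3 f" "smooth_SU3 h"
    for k and f :: "mat3 \<Rightarrow> 'a" and h :: "mat3 \<Rightarrow> 'b"
    using that
  proof (induction k arbitrary: f h)
    case 0
    then have "continuous_on SU3 f" "continuous_on SU3 h"
      unfolding smooth_SU3_def by (metis C_k_on_SU3.simps(1))+
    then show ?case by (simp add: bounded_bilinear.continuous_on[OF B])
  next
    case (Suc k)
    note d = smooth_differentiable[OF Suc.prems(1)] smooth_differentiable[OF Suc.prems(2)]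
    have diff: "(\<lambda>q. B (f q) (h q)) differentiable (at p within SU3)" if "p \<in> SU3" for p
      using bounded_bilinear.FDERIV[OF B left_deriv_works[OF d(1)[OF that]] left_deriv_works[OF d(2)[OF that]]]
      by (auto simp: differentiable_def)
    have "C_k_on_SU3 k (\<lambda>p. left_deriv (\<lambda>q. B (f q) (h q)) p v)" if v: "v \<in> su3" for v
    proof -
      have "C_k_on_SU3 j (\<lambda>q. B (f q) (left_deriv h q v))" "C_k_on_SU3 j (\<lambda>q. B (left_deriv f q v) (h q))"
        if "j = k" for j
        using Suc.IH smooth_left_deriv[OF _ v] Suc.prems that by blast+
      then have "C_k_on_SU3 k (\<lambda>q. B (f q) (left_deriv h q v) + B (left_deriv f q v) (h q))"
        using C_k_add by blast
      then show ?thesis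
        by (rule C_k_cong[rotated]) (simp add: left_deriv_bilinear[OF B d] v)
    qed
    then show ?case using diff by simp
  qed
  then show ?thesis using assms by (simp add: smooth_SU3_def)
qed

text \<open>The left derivative of a linear map is again linear in the base point, so the induction
  runs over all linear maps.\<close>

lemma smooth_linear:
  assumes "bounded_linear L" shows "smooth_SU3 L"
proof -
  have "C_k_on_SU3 k L" if "bounded_linear L" for k and L :: "mat3 \<Rightarrow> 'a"
    using that
  proof (induction k arbitrary: L)
    case 0
    then show ?case by (simp add: linear_continuous_on)
  next
    case (Suc k)
    have "C_k_on_SU3 k (\<lambda>p. left_deriv L p v)" if v: "v \<in> su3" for v
    proof (rule C_k_cong)
      show "C_k_on_SU3 k (\<lambda>p. L (p ** v))"
        using bounded_linear_compose[OF Suc.prems bounded_bilinear.bounded_linear_left[OF bounded_bilinear_matrix_mult]]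
        by (rule Suc.IH)
    qed (simp add: left_deriv_of_linear[OF Suc.prems] v)
    moreover have "L differentiable (at p within SU3)" for p
      using bounded_linear_imp_differentiable[OF Suc.prems] .
    ultimately show ?case by simp
  qed
  then show ?thesis using assms by (simp add: smooth_SU3_def)
qed

lemma left_deriv_const: "p \<in> SU3 \<Longrightarrow> v \<in> su3 \<Longrightarrow> left_deriv (\<lambda>q. c) p v = 0"
  using left_deriv_eq[OF has_derivative_const] by blast

lemma smooth_const: "smooth_SU3 (\<lambda>q. c)"
proof -
  have "C_k_on_SU3 k (\<lambda>q. c)" for k and c :: 'a
  proof (induction k arbitrary: c)
    case (Suc k)
    have "C_k_on_SU3 k (\<lambda>p. left_deriv (\<lambda>q. c) p v)" if "v \<in> su3" for v
      by (rule C_k_cong[OF _ Suc.IH[of 0]]) (simp add: left_deriv_const that)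
    then show ?case by simp
  qed simp
  then show ?thesis by (simp add: smooth_SU3_def)
qed

lemma bounded_linear_herm_adj: "bounded_linear herm_adj"
  using linear_herm_adj by (simp add: linear_conv_bounded_linear)

lemma bounded_linear_mm_part: "bounded_linear mm_part"
  using linear_mm_part by (simp add: linear_conv_bounded_linear)

lemma bounded_linear_inv_acs: "bounded_linear (inv_acs \<epsilon>)"
  using linear_inv_acs by (simp add: linear_conv_bounded_linear)

lemma bounded_linear_entry: "bounded_linear (\<lambda>A::mat3. A $ i $ j)"
  by (simp add: linear_conv_bounded_linear[symmetric] linearI)

lemma smooth_mult: "smooth_SU3 f \<Longrightarrow> smooth_SU3 h \<Longrightarrow> smooth_SU3 (\<lambda>q. (f q :: mat3) ** (h q :: mat3))"
  by (rule smooth_bilinear[OF bounded_bilinear_matrix_mult])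

lemma smooth_minus: "smooth_SU3 f \<Longrightarrow> smooth_SU3 (\<lambda>q. - f q)"
  by (rule smooth_compose_linear[OF bounded_linear_minus[OF bounded_linear_ident]])

lemma smooth_diff: "smooth_SU3 f \<Longrightarrow> smooth_SU3 h \<Longrightarrow> smooth_SU3 (\<lambda>q. f q - h q)"
  using smooth_add[OF _ smooth_minus] by fastforce

text \<open>Since the adjoint of \<open>v\<close> is \<open>- v\<close>, the derivatives of the two
  outer factors combine into a commutator.\<close>

lemma left_deriv_conj:
  assumes M: "M differentiable (at p within SU3)" and p: "p \<in> SU3" and v: "v \<in> su3"
  shows "left_deriv (\<lambda>q. q ** M q ** herm_adj q) p v = p ** (comm v (M p) + left_deriv M p v) ** herm_adj p"
proof -
  interpret mm: bounded_bilinear "(**) :: mat3 \<Rightarrow> mat3 \<Rightarrow> mat3" by (rule bounded_bilinear_matrix_mult)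
  have v': "herm_adj v = - v" using v by (simp add: su3_def)
  have 1: "((\<lambda>q. q ** M q) has_derivative (\<lambda>h. p ** frechet_derivative M (at p within SU3) h + h ** M p))
      (at p within SU3)"
    by (rule mm.FDERIV[OF has_derivative_ident left_deriv_works[OF M]])
  have "left_deriv (\<lambda>q. q ** M q ** herm_adj q) p v =
    p ** M p ** herm_adj (p ** v) + (p ** left_deriv M p v + p ** v ** M p) ** herm_adj p"
    using left_deriv_eq[OF mm.FDERIV[OF 1 bounded_linear_imp_has_derivative[OF bounded_linear_herm_adj]] p v]
    by (simp add: left_deriv_def)
  also have "\<dots> = p ** (comm v (M p) + left_deriv M p v) ** herm_adj p"
    by (simp add: herm_adj_mult v' comm_def mm.add_left mm.add_right mm.diff_left mm.diff_right
        mm.minus_left mm.minus_right matrix_mul_assoc)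
  finally show ?thesis .
qed

lemma comm_jacobi: "comm A (comm B C) - comm B (comm A C) = comm (comm A B) C"
proof -
  interpret mm: bounded_bilinear "(**) :: mat3 \<Rightarrow> mat3 \<Rightarrow> mat3" by (rule bounded_bilinear_matrix_mult)
  show ?thesis by (simp add: comm_def mm.diff_left mm.diff_right matrix_mul_assoc algebra_simps)
qed

lemma bounded_bilinear_comm: "bounded_bilinear comm"
proof -
  interpret mm: bounded_bilinear "(**) :: mat3 \<Rightarrow> mat3 \<Rightarrow> mat3" by (rule bounded_bilinear_matrix_mult)
  show ?thesis
    unfolding bilinear_conv_bounded_bilinear[symmetric]
    by (rule bilinear_intro) (simp_all add: comm_def mm.add_left mm.add_right mm.scaleR_left mm.scaleR_right
        algebra_simps)
qed

subsection \<open>Functions separating tangent vectors of the flag manifold\<close>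

text \<open>Having distinct eigenvalues, this matrix has the torus as its stabiliser under
  conjugation by SU(3); its orbit is therefore an embedded copy of the flag manifold.\<close>

definition reg :: mat3 where
  "reg = (\<chi> i j. if i = j then (if i = 1 then 1 else if i = 2 then 2 else 3) else 0)"

lemma diagonal_reg: "diagonal reg"
  by (simp add: diagonal_def reg_def)

text \<open>A real linear coordinate on the orbit of \<open>reg\<close>, selected by
  \<open>b\<close>.\<close>

definition sep_fun :: "mat3 \<Rightarrow> mat3 \<Rightarrow> real" where
  "sep_fun b q = (q ** reg ** herm_adj q) \<bullet> b"

lemma torus_nth:
  assumes "t \<in> torus"
  shows "i \<noteq> j \<Longrightarrow> t $ i $ j = 0" "t $ i $ i * cnj (t $ i $ i) = 1"
proof -
  show z: "t $ i $ j = 0" if "i \<noteq> j" for i j using assms that by (simp add: torus_def diagonal_def)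
  have "(t ** herm_adj t) $ i $ i = 1"
    using assms SU3_unitary(1)[of t] by (simp add: torus_def mat_def)
  moreover have "(t ** herm_adj t) $ i $ i = t $ i $ i * cnj (t $ i $ i)"
    by (simp add: matrix_matrix_mult_def z sum.remove[of _ i])
  ultimately show "t $ i $ i * cnj (t $ i $ i) = 1" by simp
qed

lemma torus_conj_nth:
  assumes "t \<in> torus"
  shows "(herm_adj t ** M ** t) $ i $ j = cnj (t $ i $ i) * M $ i $ j * t $ j $ j"
proof -
  have 1: "(herm_adj t ** M) $ i $ k = cnj (t $ i $ i) * M $ i $ k" for k
    using torus_nth(1)[OF assms] by (simp add: matrix_matrix_mult_def sum.remove[of _ i])
  show ?thesis
    unfolding matrix_matrix_mult_def[of "herm_adj t ** M"]
    using torus_nth(1)[OF assms] by (simp add: 1 sum.remove[of _ j])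
qed

lemma torus_SU3: "t \<in> torus \<Longrightarrow> t \<in> SU3"
  by (simp add: torus_def)

lemma smooth_fun_sep_fun: "smooth_fun (sep_fun b)"
proof -
  interpret mm: bounded_bilinear "(**) :: mat3 \<Rightarrow> mat3 \<Rightarrow> mat3" by (rule bounded_bilinear_matrix_mult)
  have "smooth_SU3 (\<lambda>q. (q ** reg ** herm_adj q) \<bullet> b)"
    by (intro smooth_compose_linear[OF bounded_linear_inner_left] smooth_mult smooth_linear
        mm.bounded_linear_left bounded_linear_herm_adj)
  then have "smooth_SU3 (sep_fun b)" by (simp add: sep_fun_def[abs_def])
  moreover have "sep_fun b (p ** t) = sep_fun b p" if t: "t \<in> torus" for p t
  proof -
    have "herm_adj t ** reg ** t = reg"
    proof (rule mat3_eqI)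
      fix i j
      show "(herm_adj t ** reg ** t) $ i $ j = reg $ i $ j"
        using torus_nth(2)[OF t, of i]
        by (cases "i = j") (simp_all add: torus_conj_nth[OF t] reg_def mult.commute)
    qed
    then have "t ** (herm_adj t ** reg ** t) ** herm_adj t = t ** reg ** herm_adj t" by simp
    moreover have "t ** (herm_adj t ** reg ** t) ** herm_adj t = (t ** herm_adj t) ** reg ** (t ** herm_adj t)"
      by (simp add: matrix_mul_assoc)
    ultimately have "t ** reg ** herm_adj t = reg"
      using SU3_unitary(1)[OF torus_SU3[OF t]] by simp
    then have "p ** t ** reg ** herm_adj (p ** t) = p ** reg ** herm_adj p"
      by (simp add: herm_adj_mult matrix_mul_assoc) (metis matrix_mul_assoc)
    then show ?thesis by (simp add: sep_fun_def)
  qed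
  ultimately show ?thesis by (simp add: smooth_fun_def)
qed

lemma left_deriv_conj_inner:
  assumes M: "M differentiable (at p within SU3)" and p: "p \<in> SU3" and v: "v \<in> su3"
  shows "left_deriv (\<lambda>q. (q ** M q ** herm_adj q) \<bullet> b) p v
    = (p ** (comm v (M p) + left_deriv M p v) ** herm_adj p) \<bullet> b"
proof -
  interpret mm: bounded_bilinear "(**) :: mat3 \<Rightarrow> mat3 \<Rightarrow> mat3" by (rule bounded_bilinear_matrix_mult)
  have 1: "((\<lambda>q. q ** M q) has_derivative (\<lambda>h. p ** frechet_derivative M (at p within SU3) h + h ** M p))
      (at p within SU3)"
    by (rule mm.FDERIV[OF has_derivative_ident left_deriv_works[OF M]])
  have d: "(\<lambda>q. q ** M q ** herm_adj q) differentiable (at p within SU3)"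
    using mm.FDERIV[OF 1 bounded_linear_imp_has_derivative[OF bounded_linear_herm_adj]]
    unfolding differentiable_def by blast
  show ?thesis
    using left_deriv_compose_linear[OF bounded_linear_inner_left[of b] d p v] left_deriv_conj[OF assms] by simp
qed

lemma left_deriv_sep_fun:
  assumes "p \<in> SU3" "v \<in> su3"
  shows "left_deriv (sep_fun b) p v = (p ** comm v reg ** herm_adj p) \<bullet> b"
  using left_deriv_conj_inner[of "\<lambda>q. reg", OF _ assms]
  by (simp add: sep_fun_def[abs_def] left_deriv_const[OF assms])

text \<open>Commuting with \<open>reg\<close> multiplies each off-diagonal entry by a nonzero
  difference of eigenvalues, so the derivatives recover everything but the diagonal.\<close>

lemma sep_fun_separates:
  assumes "p \<in> SU3" "v \<in> su3" "w \<in> su3"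
    and eq: "\<And>b. left_deriv (sep_fun b) p v = left_deriv (sep_fun b) p w"
  shows "mm_part v = mm_part w"
proof -
  have "p ** comm v reg ** herm_adj p = p ** comm w reg ** herm_adj p"
    using eq assms by (intro vector_eq_rdot[THEN iffD1]) (simp add: left_deriv_sep_fun)
  then have "herm_adj p ** (p ** comm v reg ** herm_adj p) ** p
    = herm_adj p ** (p ** comm w reg ** herm_adj p) ** p" by simp
  then have "(herm_adj p ** p) ** comm v reg ** (herm_adj p ** p)
    = (herm_adj p ** p) ** comm w reg ** (herm_adj p ** p)"
    by (simp only: matrix_mul_assoc)
  then have eq: "comm v reg = comm w reg" using SU3_unitary(2)[OF assms(1)] by simp
  have swap: "comm a reg = - comm reg a" for a by (simp add: comm_def)
  have "(reg $ i $ i - reg $ j $ j) * v $ i $ j = (reg $ i $ i - reg $ j $ j) * w $ i $ j" for i j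
    using eq comm_diagonal_nth[OF diagonal_reg, symmetric] by (simp add: swap)
  moreover have "reg $ i $ i - reg $ j $ j \<noteq> 0" if "i \<noteq> j" for i j
    using that exhaust_3[of i] exhaust_3[of j] by (elim disjE) (simp_all add: reg_def)
  ultimately show ?thesis by (intro mat3_eqI) auto
qed

text \<open>The space \<open>mm\<close> is cut out by real linear equations, which pass to the
  derivative.\<close>

lemma left_deriv_mm:
  assumes X: "smooth_SU3 X" "\<And>q. q \<in> SU3 \<Longrightarrow> X q \<in> mm" and p: "p \<in> SU3" and v: "v \<in> su3"
  shows "left_deriv X p v \<in> mm"
proof -
  note d = smooth_differentiable[OF X(1) p]
  have "herm_adj (left_deriv X p v) = left_deriv (\<lambda>q. herm_adj (X q)) p v"
    by (rule left_deriv_compose_linear[OF bounded_linear_herm_adj d p v, symmetric])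
  also have "\<dots> = left_deriv (\<lambda>q. - X q) p v"
    by (subst left_deriv_cong[OF _ p, of _ "\<lambda>q. - X q"]) (use X(2) in \<open>auto simp: mm_iff\<close>)
  also have "\<dots> = - left_deriv X p v"
    by (rule left_deriv_compose_linear[OF bounded_linear_minus[OF bounded_linear_ident] d p v])
  finally have 1: "herm_adj (left_deriv X p v) = - left_deriv X p v" .
  have "left_deriv X p v $ i $ i = 0" for i
  proof -
    have "left_deriv X p v $ i $ i = left_deriv (\<lambda>q. X q $ i $ i) p v"
      by (rule left_deriv_compose_linear[OF bounded_linear_entry d p v, symmetric])
    also have "\<dots> = left_deriv (\<lambda>q. 0) p v"
      by (subst left_deriv_cong[OF _ p, of _ "\<lambda>q. 0"]) (use X(2) in \<open>auto simp: mm_iff\<close>)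
    finally show ?thesis using left_deriv_const[OF p v] by simp
  qed
  with 1 show ?thesis by (simp add: mm_iff)
qed

subsection \<open>Vector fields\<close>

lemma vfieldD:
  assumes "smooth_vfield X"
  shows "smooth_SU3 X" "\<And>p. p \<in> SU3 \<Longrightarrow> X p \<in> mm" "\<And>p. p \<in> SU3 \<Longrightarrow> X p \<in> su3"
    "\<And>p t. p \<in> SU3 \<Longrightarrow> t \<in> torus \<Longrightarrow> X (p ** t) = herm_adj t ** X p ** t"
    "\<And>p. p \<in> SU3 \<Longrightarrow> X differentiable (at p within SU3)"
    "\<And>p v. p \<in> SU3 \<Longrightarrow> v \<in> su3 \<Longrightarrow> left_deriv X p v \<in> mm"
  using assms mm_subset_su3 left_deriv_mm[of X] unfolding smooth_vfield_def
  by (auto intro: smooth_differentiable)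

lemma smooth_vfield_cong:
  assumes "\<And>q. q \<in> SU3 \<Longrightarrow> X q = Y q" "smooth_vfield X"
  shows "smooth_vfield Y"
  using assms smooth_cong[of X Y] SU3_mult torus_SU3 unfolding smooth_vfield_def by metis

text \<open>The first derivative is again a conjugate, now of the commutator of \<open>Y\<close>
  with \<open>reg\<close>, so the rule for conjugates applies a second time.\<close>

lemma bracket_sep_fun:
  assumes X: "smooth_vfield X" and Y: "smooth_vfield Y" and p: "p \<in> SU3"
  shows "vderiv X (vderiv Y (sep_fun b)) p =
    (p ** (comm (X p) (comm (Y p) reg) + comm (left_deriv Y p (X p)) reg) ** herm_adj p) \<bullet> b"
proof -
  have lin: "bounded_linear (\<lambda>A. comm A reg)"
    by (rule bounded_bilinear.bounded_linear_left[OF bounded_bilinear_comm])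
  have "smooth_SU3 (\<lambda>q. comm (Y q) reg)"
    by (rule smooth_compose_linear[OF lin vfieldD(1)[OF Y]])
  note d = smooth_differentiable[OF this p]
  have "vderiv X (vderiv Y (sep_fun b)) p
    = left_deriv (\<lambda>q. (q ** comm (Y q) reg ** herm_adj q) \<bullet> b) p (X p)"
    unfolding vderiv_def[of X]
    by (subst left_deriv_cong[OF _ p, of _ "\<lambda>q. (q ** comm (Y q) reg ** herm_adj q) \<bullet> b"])
      (simp_all add: vderiv_def left_deriv_sep_fun vfieldD(3)[OF Y])
  then show ?thesis
    using left_deriv_conj_inner[OF d p vfieldD(3)[OF X p]]
      left_deriv_compose_linear[OF lin vfieldD(5)[OF Y p] p vfieldD(3)[OF X p]] by simp
qed

text \<open>Testing on \<open>sep_fun\<close> avoids the symmetry of second derivatives.\<close>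

lemma bracket_unique:
  assumes X: "smooth_vfield X" and Y: "smooth_vfield Y" and p: "p \<in> SU3" and u: "u \<in> mm"
    and eq: "\<And>\<phi>. smooth_fun \<phi> \<Longrightarrow>
      left_deriv \<phi> p u = vderiv X (vderiv Y \<phi>) p - vderiv Y (vderiv X \<phi>) p"
  shows "u = mm_part (comm (X p) (Y p)) + left_deriv Y p (X p) - left_deriv X p (Y p)"
proof -
  interpret mm: bounded_bilinear "(**) :: mat3 \<Rightarrow> mat3 \<Rightarrow> mat3" by (rule bounded_bilinear_matrix_mult)
  interpret cm: bounded_bilinear comm by (rule bounded_bilinear_comm)
  define dY where "dY = left_deriv Y p (X p)"
  define dX where "dX = left_deriv X p (Y p)"
  have d: "dX \<in> mm" "dY \<in> mm"
    unfolding dX_def dY_def using vfieldD X Y p by auto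
  \<comment> \<open>The torus part of the commutator is kept here, since the Jacobi identity
    produces the full commutator; \<open>mm_part\<close> removes it at the end.\<close>
  define w where "w = comm (X p) (Y p) + (dY - dX)"
  have "comm (X p) (Y p) \<in> su3"
    using comm_su3[OF vfieldD(3)[OF X p] vfieldD(3)[OF Y p]]
    by (simp add: su3_def comm_def trace_def sum_3 matrix_mult_nth)
  then have w: "w \<in> su3"
    unfolding w_def using d mm_subset_su3 subspace_add[OF subspace_su3] subspace_diff[OF subspace_su3]
    by blast
  have "left_deriv (sep_fun b) p u = left_deriv (sep_fun b) p w" for b
  proof -
    have "left_deriv (sep_fun b) p u = (p ** ((comm (X p) (comm (Y p) reg) - comm (Y p) (comm (X p) reg))
        + comm (dY - dX) reg) ** herm_adj p) \<bullet> b"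
      unfolding eq[OF smooth_fun_sep_fun] bracket_sep_fun[OF X Y p] bracket_sep_fun[OF Y X p] dX_def dY_def
      by (simp add: mm.diff_left mm.diff_right mm.add_left mm.add_right cm.diff_left inner_diff_left
          inner_add_left)
    also have "\<dots> = left_deriv (sep_fun b) p w"
      unfolding comm_jacobi left_deriv_sep_fun[OF p w] by (simp add: w_def cm.add_left)
    finally show ?thesis .
  qed
  then have "mm_part u = mm_part w"
    using sep_fun_separates[OF p _ w] u mm_subset_su3 by blast
  then show ?thesis
    using u d by (simp add: w_def linear_add[OF linear_mm_part] linear_diff[OF linear_mm_part] dX_def dY_def)
qed

lemma mm_part_torus_conj:
  "t \<in> torus \<Longrightarrow> mm_part (herm_adj t ** M ** t) = herm_adj t ** mm_part M ** t"
  by (rule mat3_eqI) (simp add: torus_conj_nth)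

lemma skew_conj: "herm_adj a = - a \<Longrightarrow> herm_adj (herm_adj q ** a ** q) = - (herm_adj q ** a ** q)"
  by (simp add: herm_adj_mult matrix_mul_assoc bounded_bilinear.minus_left[OF bounded_bilinear_matrix_mult]
      bounded_bilinear.minus_right[OF bounded_bilinear_matrix_mult])

lemma smooth_conj: "smooth_SU3 (\<lambda>q. herm_adj q ** a ** q)"
proof -
  interpret mm: bounded_bilinear "(**) :: mat3 \<Rightarrow> mat3 \<Rightarrow> mat3" by (rule bounded_bilinear_matrix_mult)
  show ?thesis
    by (intro smooth_mult smooth_linear smooth_const bounded_linear_herm_adj bounded_linear_ident)
qed

lemma smooth_vfield_extend:
  assumes "a \<in> mm" shows "smooth_vfield (extend p a)"
proof -
  define B where "B = p ** a ** herm_adj p"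
  have B: "herm_adj B = - B"
    using skew_conj[of a "herm_adj p"] assms by (simp add: mm_iff B_def)
  have E: "extend p a = (\<lambda>q. mm_part (herm_adj q ** B ** q))"
    by (simp add: extend_def B_def)
  show ?thesis
    unfolding smooth_vfield_def E
  proof (intro conjI ballI)
    show "smooth_SU3 (\<lambda>q. mm_part (herm_adj q ** B ** q))"
      by (rule smooth_compose_linear[OF bounded_linear_mm_part smooth_conj])
    show "mm_part (herm_adj q ** B ** q) \<in> mm" for q
      by (rule mm_part_in_mm[OF skew_conj[OF B]])
    show "mm_part (herm_adj (q ** t) ** B ** (q ** t)) = herm_adj t ** mm_part (herm_adj q ** B ** q) ** t"
      if "t \<in> torus" for q t
      using mm_part_torus_conj[OF that, of "herm_adj q ** B ** q"]
      by (simp add: herm_adj_mult matrix_mul_assoc)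
  qed
qed

lemma conj_at_base: "p \<in> SU3 \<Longrightarrow> herm_adj p ** (p ** a ** herm_adj p) ** p = a"
  using SU3_unitary(2)[of p] by (metis matrix_mul_assoc matrix_mul_lid matrix_mul_rid)

lemma extend_at_base: "p \<in> SU3 \<Longrightarrow> a \<in> mm \<Longrightarrow> extend p a p = a"
  by (simp add: extend_def conj_at_base)

lemma left_deriv_adj_conj:
  assumes "q \<in> SU3" "v \<in> su3"
  shows "left_deriv (\<lambda>q. herm_adj q ** a ** q) q v = comm (herm_adj q ** a ** q) v"
proof -
  interpret mm: bounded_bilinear "(**) :: mat3 \<Rightarrow> mat3 \<Rightarrow> mat3" by (rule bounded_bilinear_matrix_mult)
  have v': "herm_adj v = - v" using assms by (simp add: su3_def)
  have 1: "((\<lambda>q. herm_adj q ** a) has_derivative (\<lambda>h. herm_adj h ** a)) (at q within SU3)"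
    by (rule bounded_linear_imp_has_derivative
        [OF bounded_linear_compose[OF mm.bounded_linear_left bounded_linear_herm_adj]])
  show ?thesis
    using left_deriv_eq[OF mm.FDERIV[OF 1 has_derivative_ident] assms]
    by (simp add: herm_adj_mult v' comm_def mm.minus_left mm.minus_right matrix_mul_assoc)
qed

lemma left_deriv_extend:
  assumes "q \<in> SU3" "v \<in> su3"
  shows "left_deriv (extend p a) q v = mm_part (comm (herm_adj q ** (p ** a ** herm_adj p) ** q) v)"
  unfolding extend_def
  by (simp add: left_deriv_compose_linear[OF bounded_linear_mm_part smooth_differentiable[OF smooth_conj assms(1)] assms]
      left_deriv_adj_conj[OF assms])


subsection \<open>Invariant metrics\<close>

text \<open>On sl(3) the Killing form is 6 tr(XY), whence the factor.\<close>

lemma killing_uu_part: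
  "killing (uu_part 1 2 X) (uu_part 1 2 Y) = 6 * (X $ 1 $ 2 * Y $ 2 $ 1 + X $ 2 $ 1 * Y $ 1 $ 2)"
  "killing (uu_part 2 3 X) (uu_part 2 3 Y) = 6 * (X $ 2 $ 3 * Y $ 3 $ 2 + X $ 3 $ 2 * Y $ 2 $ 3)"
  "killing (uu_part 1 3 X) (uu_part 1 3 Y) = 6 * (X $ 1 $ 3 * Y $ 3 $ 1 + X $ 3 $ 1 * Y $ 1 $ 3)"
  by (simp_all add: killing_def sum_3 comm_nth matrix_mult_nth uu_part_def unit_mat_def algebra_simps)

text \<open>The complex bilinear extension of the metric, written without real parts so that it can
  be evaluated on (1,0) vectors.\<close>

definition metricC :: "real \<Rightarrow> real \<Rightarrow> real \<Rightarrow> mat3 \<Rightarrow> mat3 \<Rightarrow> complex" where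
  "metricC x y z X Y = - 6 * (of_real x * (X $ 1 $ 2 * Y $ 2 $ 1 + X $ 2 $ 1 * Y $ 1 $ 2)
     + of_real y * (X $ 2 $ 3 * Y $ 3 $ 2 + X $ 3 $ 2 * Y $ 2 $ 3)
     + of_real z * (X $ 1 $ 3 * Y $ 3 $ 1 + X $ 3 $ 1 * Y $ 1 $ 3))"

lemma inv_metric_eq: "inv_metric x y z X Y = Re (metricC x y z X Y)"
  by (simp add: inv_metric_def killing_uu_part metricC_def algebra_simps)

lemma bounded_bilinear_inv_metric: "bounded_bilinear (inv_metric x y z)"
  unfolding bilinear_conv_bounded_bilinear[symmetric]
  by (rule bilinear_intro) (simp_all add: inv_metric_eq metricC_def algebra_simps)

lemma inv_metric_mk:
  "inv_metric x y z (mk a b c) (mk a' b' c')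
    = 12 * (x * Re (a * cnj a') + y * Re (b * cnj b') + z * Re (c * cnj c'))"
  by (simp add: inv_metric_eq metricC_def algebra_simps)

lemma inv_metric_sym: "inv_metric x y z X Y = inv_metric x y z Y X"
  by (simp add: inv_metric_eq metricC_def algebra_simps)

lemma inv_metric_mm: "X \<in> mm \<Longrightarrow> Y \<in> mm \<Longrightarrow> of_real (inv_metric x y z X Y) = metricC x y z X Y"
  by (elim mm_cases) (simp add: inv_metric_mk metricC_def complex_eq_iff algebra_simps)

lemma mk_eq_iff: "mk a b c = mk a' b' c' \<longleftrightarrow> a = a' \<and> b = b' \<and> c = c'"
  by (metis mk_nth(2,3,6))

lemma mk_add: "mk a b c + mk a' b' c' = mk (a + a') (b + b') (c + c')"
  by (simp add: vec_eq_iff forall_3)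

lemma mk_diff: "mk a b c - mk a' b' c' = mk (a - a') (b - b') (c - c')"
  by (simp add: vec_eq_iff forall_3)

lemma mk_minus: "- mk a b c = mk (- a) (- b) (- c)"
  by (simp add: vec_eq_iff forall_3)

lemma mk_0 [simp]: "mk 0 0 0 = 0"
  by (simp add: vec_eq_iff forall_3)

lemma inv_metric_pos:
  assumes "x > 0" "y > 0" "z > 0" "X \<in> mm" "inv_metric x y z X X = 0"
  shows "X = 0"
proof -
  obtain a b c where X: "X = mk a b c" using mm_cases[OF assms(4)] .
  have re: "Re (u * cnj u) = (cmod u)\<^sup>2" for u
    by (simp add: cmod_def power2_eq_square)
  have "x * (cmod a)\<^sup>2 + y * (cmod b)\<^sup>2 + z * (cmod c)\<^sup>2 = 0"
    using assms(5) unfolding X inv_metric_mk re by simp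
  moreover have "x * (cmod a)\<^sup>2 \<ge> 0" "y * (cmod b)\<^sup>2 \<ge> 0" "z * (cmod c)\<^sup>2 \<ge> 0"
    using assms by simp_all
  ultimately have "x * (cmod a)\<^sup>2 = 0" "y * (cmod b)\<^sup>2 = 0" "z * (cmod c)\<^sup>2 = 0"
    by linarith+
  then show ?thesis using assms(1-3) by (simp add: X)
qed

section \<open>Nomizu's operator of the invariant metric\<close>

definition lam :: "real \<Rightarrow> real \<Rightarrow> real \<Rightarrow> 3 \<Rightarrow> 3 \<Rightarrow> real" where
  "lam x y z i j = (if {i, j} = {1, 2} then x else if {i, j} = {2, 3} then y
     else if {i, j} = {1, 3} then z else 0)"

lemma lam_simps [simp]:
  "lam x y z 1 2 = x" "lam x y z 2 1 = x" "lam x y z 2 3 = y" "lam x y z 3 2 = y"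
  "lam x y z 1 3 = z" "lam x y z 3 1 = z"
  by (simp_all add: lam_def doubleton_eq_iff)

text \<open>The summand 1/2 comes from half the bracket; the quotient is the symmetric term in
  Koszul's formula.\<close>

definition nomizu_coeff :: "real \<Rightarrow> real \<Rightarrow> real \<Rightarrow> 3 \<Rightarrow> 3 \<Rightarrow> 3 \<Rightarrow> complex" where
  "nomizu_coeff x y z i j k = of_real ((1 + (lam x y z j k - lam x y z i j) / lam x y z i k) / 2)"

text \<open>On \<open>X \<in> \<uu>\<^sub>i\<^sub>j\<close> and \<open>Y \<in> \<uu>\<^sub>j\<^sub>k\<close> this is
  \<open>(1 + (\<lambda>\<^sub>j\<^sub>k - \<lambda>\<^sub>i\<^sub>j) / \<lambda>\<^sub>i\<^sub>k) / 2 \<cdot> [X, Y]\<close>, Nomizu's operator of the Levi-Civita connection.\<close>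

definition nomizu :: "real \<Rightarrow> real \<Rightarrow> real \<Rightarrow> mat3 \<Rightarrow> mat3 \<Rightarrow> mat3" where
  "nomizu x y z X Y = (\<chi> i k. if i = k then 0 else
     \<Sum>j\<in>UNIV. nomizu_coeff x y z i j k * X $ i $ j * Y $ j $ k - nomizu_coeff x y z k j i * Y $ i $ j * X $ j $ k)"

lemma bounded_bilinear_nomizu: "bounded_bilinear (nomizu x y z)"
  unfolding bilinear_conv_bounded_bilinear[symmetric]
  by (rule bilinear_intro; rule mat3_eqI) (simp_all add: nomizu_def sum_3 algebra_simps)

lemma nomizu_mk:
  "nomizu x y z (mk a b c) (mk a' b' c') =
    mk (of_real ((1 + (z - y) / x) / 2) * c' * cnj b - of_real ((1 + (y - z) / x) / 2) * c * cnj b')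
       (of_real ((1 + (x - z) / y) / 2) * cnj a' * c - of_real ((1 + (z - x) / y) / 2) * cnj a * c')
       (of_real ((1 + (y - x) / z) / 2) * a * b' - of_real ((1 + (x - y) / z) / 2) * a' * b)"
  by (simp add: vec_eq_iff forall_3 nomizu_def nomizu_coeff_def sum_3 mult_ac)

lemma mm_comm_mk:
  "mm_part (comm (mk a b c) (mk a' b' c')) =
    mk (c' * cnj b - c * cnj b') (cnj a' * c - cnj a * c') (a * b' - a' * b)"
  by (simp add: vec_eq_iff forall_3 comm_nth matrix_mult_nth)

lemma nomizu_mm: "X \<in> mm \<Longrightarrow> Y \<in> mm \<Longrightarrow> nomizu x y z X Y \<in> mm"
  by (elim mm_cases) (simp add: nomizu_mk)

text \<open>The symmetric term cancels: the two coefficients in front of each product of entries add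
  up to one.\<close>

lemma nomizu_torsion:
  assumes "X \<in> mm" "Y \<in> mm"
  shows "nomizu x y z X Y - nomizu x y z Y X = mm_part (comm X Y)"
proof -
  obtain a b c a' b' c' where XY: "X = mk a b c" "Y = mk a' b' c'"
    using assms by (elim mm_cases)
  have half: "of_real ((1 + (u - v) / w) / 2) * p + of_real ((1 + (v - u) / w) / 2) * p = p"
    for u v w :: real and p :: complex
  proof -
    have "(1 + (u - v) / w) / 2 + (1 + (v - u) / w) / 2 = 1"
      by (simp add: diff_divide_distrib add_divide_distrib)
    then show ?thesis by (metis distrib_right mult_1 of_real_1 of_real_add)
  qed
  show ?thesis
    unfolding XY nomizu_mk mm_comm_mk mk_diff mk_eq_iff
    using half[of z y x "c' * cnj b"] half[of y z x "c * cnj b'"] half[of x z y "cnj a' * c"]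
      half[of z x y "cnj a * c'"] half[of y x z "a * b'"] half[of x y z "a' * b"]
    by (simp add: algebra_simps)
qed

text \<open>Multiplying a coefficient by the parameter of the target summand clears its denominator.
  The result is symmetric in the summands of \<open>Y\<close> and \<open>Z\<close>, while the
  pairing of the bracket with them is antisymmetric.\<close>

lemma nomizu_skew:
  assumes "x > 0" "y > 0" "z > 0" "X \<in> mm" "Y \<in> mm" "Z \<in> mm"
  shows "inv_metric x y z (nomizu x y z X Y) Z + inv_metric x y z Y (nomizu x y z X Z) = 0"
proof -
  obtain a b c a' b' c' a'' b'' c'' where XYZ: "X = mk a b c" "Y = mk a' b' c'" "Z = mk a'' b'' c''"
    using assms(4-) by (elim mm_cases)
  have coeff: "w * ((1 + (u - v) / w) / 2) = (w + u - v) / 2" if "w > 0" for u v w :: real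
    using that by (simp add: field_simps)
  have re: "w * Re ((of_real k * p * q - of_real k' * p' * q') * r)
      = (w * k) * Re (p * q * r) - (w * k') * Re (p' * q' * r)"
    "w * Re (r' * cnj (of_real k * p * q - of_real k' * p' * q'))
      = (w * k) * Re (r' * cnj (p * q)) - (w * k') * Re (r' * cnj (p' * q'))"
    for w k k' :: real and p q r p' q' r' :: complex
    by (simp_all add: algebra_simps)
  show ?thesis
    unfolding XYZ nomizu_mk inv_metric_mk re coeff[OF assms(1)] coeff[OF assms(2)] coeff[OF assms(3)]
    by (simp add: algebra_simps add_divide_distrib diff_divide_distrib)
qed

lemma nomizu_equivariant:
  assumes t: "t \<in> torus"
  shows "nomizu x y z (herm_adj t ** X ** t) (herm_adj t ** Y ** t) = herm_adj t ** nomizu x y z X Y ** t"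
proof (rule mat3_eqI)
  fix i k
  \<comment> \<open>The two torus factors at the summation index have product one.\<close>
  have c: "r * (cnj (t $ i $ i) * u * t $ j $ j) * (cnj (t $ j $ j) * v * t $ k $ k)
      = cnj (t $ i $ i) * (r * u * v) * t $ k $ k" for r u v i j k
    using torus_nth(2)[OF t, of j] by (simp add: mult_ac)
  show "nomizu x y z (herm_adj t ** X ** t) (herm_adj t ** Y ** t) $ i $ k
    = (herm_adj t ** nomizu x y z X Y ** t) $ i $ k"
    by (simp add: nomizu_def torus_conj_nth[OF t] c sum_3 distrib_left distrib_right
        left_diff_distrib right_diff_distrib)
qed

lemma smooth_vfield_bilinear:
  assumes B: "bounded_bilinear B" and X: "smooth_vfield X" and Y: "smooth_vfield Y"
    and mm: "\<And>a b. a \<in> mm \<Longrightarrow> b \<in> mm \<Longrightarrow> B a b \<in> mm"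
    and eq: "\<And>t a b. t \<in> torus \<Longrightarrow> a \<in> mm \<Longrightarrow> b \<in> mm \<Longrightarrow>
      B (herm_adj t ** a ** t) (herm_adj t ** b ** t) = herm_adj t ** B a b ** t"
  shows "smooth_vfield (\<lambda>q. B (X q) (Y q))"
  using smooth_bilinear[OF B vfieldD(1)[OF X] vfieldD(1)[OF Y]] vfieldD(2,4)[OF X] vfieldD(2,4)[OF Y]
  by (simp add: smooth_vfield_def mm eq)

lemma smooth_vfield_diff:
  assumes X: "smooth_vfield X" and Y: "smooth_vfield Y"
  shows "smooth_vfield (\<lambda>q. X q - Y q)"
proof -
  interpret mm: bounded_bilinear "(**) :: mat3 \<Rightarrow> mat3 \<Rightarrow> mat3" by (rule bounded_bilinear_matrix_mult)
  show ?thesis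
    using smooth_diff[OF vfieldD(1)[OF X] vfieldD(1)[OF Y]] vfieldD(2,4)[OF X] vfieldD(2,4)[OF Y]
    by (simp add: smooth_vfield_def subspace_diff[OF subspace_mm] mm.diff_left mm.diff_right)
qed

subsection \<open>The Levi-Civita connection\<close>

locale flag_metric =
  fixes x y z :: real and D :: "vfield \<Rightarrow> vfield \<Rightarrow> vfield"
  assumes pos: "x > 0" "y > 0" "z > 0"
    and lc: "levi_civita (inv_metric x y z) D"
begin

abbreviation "g \<equiv> inv_metric x y z"
abbreviation "\<Lambda> \<equiv> nomizu x y z"

lemma D_smooth: "smooth_vfield X \<Longrightarrow> smooth_vfield Z \<Longrightarrow> smooth_vfield (D X Z)"
  using lc[unfolded levi_civita_def, THEN conjunct1] by simp

lemma D_metric: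
  assumes "smooth_vfield X" "smooth_vfield Y" "smooth_vfield Z" "p \<in> SU3"
  shows "vderiv X (\<lambda>q. g (Y q) (Z q)) p = g (D X Y p) (Z p) + g (Y p) (D X Z p)"
  using lc[unfolded levi_civita_def, THEN conjunct2, THEN conjunct2, THEN conjunct2, THEN conjunct1] assms
  by simp

lemma D_torsion:
  assumes "smooth_vfield X" "smooth_vfield Y" "p \<in> SU3" "smooth_fun \<phi>"
  shows "left_deriv \<phi> p (D X Y p - D Y X p) = vderiv X (vderiv Y \<phi>) p - vderiv Y (vderiv X \<phi>) p"
  using lc[unfolded levi_civita_def, THEN conjunct2, THEN conjunct2, THEN conjunct2, THEN conjunct2] assms
  by simp

lemma D_bracket:
  assumes X: "smooth_vfield X" and Y: "smooth_vfield Y" and p: "p \<in> SU3"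
  shows "D X Y p - D Y X p = mm_part (comm (X p) (Y p)) + left_deriv Y p (X p) - left_deriv X p (Y p)"
  using bracket_unique[OF X Y p _ D_torsion[OF X Y p]] vfieldD(2)[OF D_smooth[OF X Y] p]
    vfieldD(2)[OF D_smooth[OF Y X] p] subspace_diff[OF subspace_mm] by blast

text \<open>Existence of the vector described by \<open>lie_bracket\<close> comes from the
  torsion-freeness of \<open>D\<close>, uniqueness from \<open>bracket_unique\<close>.\<close>

lemma lie_bracket_D:
  assumes X: "smooth_vfield X" and Y: "smooth_vfield Y" and p: "p \<in> SU3"
  shows "lie_bracket X Y p = D X Y p - D Y X p"
  unfolding lie_bracket_def
proof (rule the_equality)
  have "D X Y p - D Y X p \<in> mm"
    using vfieldD(2)[OF D_smooth[OF X Y] p] vfieldD(2)[OF D_smooth[OF Y X] p]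
      subspace_diff[OF subspace_mm] by blast
  then show "D X Y p - D Y X p \<in> mm \<and> (\<forall>\<phi>. smooth_fun \<phi> \<longrightarrow> left_deriv \<phi> p (D X Y p - D Y X p)
      = vderiv X (vderiv Y \<phi>) p - vderiv Y (vderiv X \<phi>) p)"
    using D_torsion[OF X Y p] by blast
next
  fix v assume "v \<in> mm \<and> (\<forall>\<phi>. smooth_fun \<phi> \<longrightarrow> left_deriv \<phi> p v
      = vderiv X (vderiv Y \<phi>) p - vderiv Y (vderiv X \<phi>) p)"
  then show "v = D X Y p - D Y X p"
    using bracket_unique[OF X Y p] D_bracket[OF X Y p] by metis
qed

lemma lie_bracket_eq:
  assumes "smooth_vfield X" "smooth_vfield Y" "p \<in> SU3"
  shows "lie_bracket X Y p = mm_part (comm (X p) (Y p)) + left_deriv Y p (X p) - left_deriv X p (Y p)"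
  using lie_bracket_D D_bracket assms by simp

lemma lie_bracket_smooth:
  assumes X: "smooth_vfield X" and Y: "smooth_vfield Y"
  shows "smooth_vfield (lie_bracket X Y)"
  by (rule smooth_vfield_cong[OF _ smooth_vfield_diff[OF D_smooth[OF X Y] D_smooth[OF Y X]]])
    (simp add: lie_bracket_D[OF X Y])

lemma metric_nondegenerate:
  assumes "v \<in> mm" "w \<in> mm" "\<And>a. a \<in> mm \<Longrightarrow> g v a = g w a"
  shows "v = w"
proof -
  have d: "v - w \<in> mm" using assms subspace_diff[OF subspace_mm] by blast
  have "g (v - w) (v - w) = 0"
    using assms(3)[OF d] bounded_bilinear.diff_left[OF bounded_bilinear_inv_metric] by simp
  then show ?thesis using inv_metric_pos[OF pos d] by simp
qed

text \<open>Koszul's argument: the difference \<open>S\<close> between \<open>D\<close> and the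
  candidate is symmetric because both have the same torsion, and skew because both are metric; such
  an \<open>S\<close> vanishes.\<close>

lemma D_eq:
  assumes X: "smooth_vfield X" and Z: "smooth_vfield Z" and p: "p \<in> SU3"
  shows "D X Z p = left_deriv Z p (X p) + \<Lambda> (X p) (Z p)"
proof -
  interpret g: bounded_bilinear g by (rule bounded_bilinear_inv_metric)
  define S where "S X Z = D X Z p - (left_deriv Z p (X p) + \<Lambda> (X p) (Z p))" for X Z
  have S_mm: "S X Z \<in> mm" if "smooth_vfield X" "smooth_vfield Z" for X Z
    unfolding S_def
    using vfieldD(2)[OF D_smooth[OF that] p] vfieldD(6)[OF that(2) p vfieldD(3)[OF that(1) p]]
      nomizu_mm[OF vfieldD(2)[OF that(1) p] vfieldD(2)[OF that(2) p]]
    by (intro subspace_diff[OF subspace_mm] subspace_add[OF subspace_mm])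
  have S_sym: "S X Z = S Z X" if "smooth_vfield X" "smooth_vfield Z" for X Z
  proof -
    have "S X Z - S Z X = 0"
      using D_bracket[OF that p] nomizu_torsion[OF vfieldD(2)[OF that(1) p] vfieldD(2)[OF that(2) p], of x y z]
      unfolding S_def by (simp add: algebra_simps)
    then show ?thesis by simp
  qed
  have S_skew: "g (S X Y) (Z p) = - g (Y p) (S X Z)"
    if X: "smooth_vfield X" and Y: "smooth_vfield Y" and Z: "smooth_vfield Z" for X Y Z
  proof -
    have "g (D X Y p) (Z p) + g (Y p) (D X Z p)
      = g (Y p) (left_deriv Z p (X p)) + g (left_deriv Y p (X p)) (Z p)"
      unfolding D_metric[OF X Y Z p, symmetric] vderiv_def
      by (rule left_deriv_bilinear[OF bounded_bilinear_inv_metric])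
        (use vfieldD(5)[OF Y p] vfieldD(5)[OF Z p] vfieldD(3)[OF X p] p in simp_all)
    with nomizu_skew[OF pos vfieldD(2)[OF X p] vfieldD(2)[OF Y p] vfieldD(2)[OF Z p]] show ?thesis
      unfolding S_def by (simp add: g.diff_left g.diff_right g.add_left g.add_right)
  qed
  have "g (S X Z) a = g 0 a" if "a \<in> mm" for a
  proof -
    define Y where "Y = extend p a"
    have Y: "smooth_vfield Y" "Y p = a"
      unfolding Y_def using smooth_vfield_extend[OF that] extend_at_base[OF p that] by simp_all
    \<comment> \<open>Alternating skewness and symmetry returns to the initial term with the
      opposite sign.\<close>
    have "g (S X Z) (Y p) = - g (S X Y) (Z p)"
      using S_skew[OF X Z Y(1)] inv_metric_sym by metis
    also have "\<dots> = g (S Y Z) (X p)"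
      using S_skew[OF Y(1) X Z] inv_metric_sym S_sym[OF X Y(1)] by (metis minus_minus)
    also have "\<dots> = - g (S Z X) (Y p)"
      using S_skew[OF Z Y(1) X] inv_metric_sym S_sym[OF Y(1) Z] by metis
    also have "\<dots> = - g (S X Z) (Y p)" using S_sym[OF X Z] by simp
    finally show ?thesis by (simp add: Y g.zero_left)
  qed
  then have "S X Z = 0"
    using metric_nondegenerate[OF S_mm[OF X Z] subspace_0[OF subspace_mm]] by blast
  then show ?thesis by (simp add: S_def)
qed

subsection \<open>Curvature of invariant connections\<close>

text \<open>Nomizu's curvature formula. The fields \<open>extend p a\<close> are not constant in the
  trivialisation; their derivatives at \<open>p\<close> combine by the Jacobi identity into the last
  term, the action of the torus part of the bracket.\<close>

lemma curvature_at_eq: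
  assumes L: "bounded_bilinear L"
    and N_smooth: "\<And>X Z. smooth_vfield X \<Longrightarrow> smooth_vfield Z \<Longrightarrow> smooth_vfield (N X Z)"
    and N_eq: "\<And>X Z q. smooth_vfield X \<Longrightarrow> smooth_vfield Z \<Longrightarrow> q \<in> SU3 \<Longrightarrow>
      N X Z q = left_deriv Z q (X q) + L (X q) (Z q)"
    and p: "p \<in> SU3" and abc: "a \<in> mm" "b \<in> mm" "c \<in> mm" "d \<in> mm"
  shows "curvature_at g N p a b c d = - g (L a (L b c) - L b (L a c) - L (mm_part (comm a b)) c
    - mm_part (comm (comm a b - mm_part (comm a b)) c)) d"
proof -
  interpret L: bounded_bilinear L by (rule L)
  interpret mm: bounded_bilinear "(**) :: mat3 \<Rightarrow> mat3 \<Rightarrow> mat3" by (rule bounded_bilinear_matrix_mult)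
  interpret cm: bounded_bilinear comm by (rule bounded_bilinear_comm)
  have swap: "comm u v = - comm v u" for u v by (simp add: comm_def)
  note lin = linear_add[OF linear_mm_part] linear_diff[OF linear_mm_part] linear_neg[OF linear_mm_part]
  define V where "V = extend p"
  have V: "smooth_vfield (V e)" "V e p = e" "e \<in> su3" if "e \<in> mm" for e
    unfolding V_def
    using smooth_vfield_extend[OF that] extend_at_base[OF p that] that mm_subset_su3 by (simp_all add: subset_eq)
  have dV: "left_deriv (V e) p v = mm_part (comm e v)" if "v \<in> su3" for e v
    unfolding V_def left_deriv_extend[OF p that] conj_at_base[OF p] ..
  have NN: "N (V a) (N (V b) (V c)) p = mm_part (comm c (mm_part (comm b a)) + comm (comm c a) b)
      + (L b (mm_part (comm c a)) + L (mm_part (comm b a)) c)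
      + L a (mm_part (comm c b) + L b c)"
    if a: "a \<in> mm" and b: "b \<in> mm" for a b
  proof -
    \<comment> \<open>The field \<open>V c\<close> before projection to \<open>mm\<close>. Its torus
      component enters the derivative of \<open>V c\<close> and must be differentiated too.\<close>
    define \<gamma> where "\<gamma> = (\<lambda>q. herm_adj q ** (p ** c ** herm_adj p) ** q)"
    have \<gamma>: "smooth_SU3 \<gamma>" "\<gamma> p = c" "left_deriv \<gamma> p a = comm c a"
      unfolding \<gamma>_def by (simp_all add: smooth_conj left_deriv_adj_conj[OF p V(3)[OF a]] conj_at_base[OF p])
    have eq: "N (V b) (V c) q = mm_part (comm (\<gamma> q) (V b q)) + L (V b q) (V c q)" if q: "q \<in> SU3" for q
      unfolding N_eq[OF V(1)[OF b] V(1)[OF abc(3)] q]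
      using left_deriv_extend[OF q vfieldD(3)[OF V(1)[OF b] q], of p c]
      by (simp add: V_def \<gamma>_def)
    note dd = smooth_differentiable[OF \<gamma>(1) p] smooth_differentiable[OF vfieldD(1)[OF V(1)[OF b]] p]
      smooth_differentiable[OF vfieldD(1)[OF V(1)[OF abc(3)]] p]
    have s: "smooth_SU3 (\<lambda>q. comm (\<gamma> q) (V b q))" "smooth_SU3 (\<lambda>q. L (V b q) (V c q))"
      by (intro smooth_bilinear[OF bounded_bilinear_comm] smooth_bilinear[OF L] \<gamma> vfieldD(1) V b abc)+
    note s' = smooth_compose_linear[OF bounded_linear_mm_part s(1)]
    have "left_deriv (N (V b) (V c)) p a
      = left_deriv (\<lambda>q. mm_part (comm (\<gamma> q) (V b q)) + L (V b q) (V c q)) p a"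
      using left_deriv_cong[OF eq p] by simp
    also have "\<dots> = mm_part (left_deriv (\<lambda>q. comm (\<gamma> q) (V b q)) p a)
        + left_deriv (\<lambda>q. L (V b q) (V c q)) p a"
      using left_deriv_add[OF smooth_differentiable[OF s' p] smooth_differentiable[OF s(2) p] p V(3)[OF a]]
        left_deriv_compose_linear[OF bounded_linear_mm_part smooth_differentiable[OF s(1) p] p V(3)[OF a]]
      by simp
    also have "\<dots> = mm_part (comm c (mm_part (comm b a)) + comm (comm c a) b)
      + (L b (mm_part (comm c a)) + L (mm_part (comm b a)) c)"
      unfolding left_deriv_bilinear[OF bounded_bilinear_comm dd(1,2) p V(3)[OF a]]
        left_deriv_bilinear[OF L dd(2,3) p V(3)[OF a]]
      by (simp add: \<gamma> dV V a b abc)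
    finally show ?thesis
      using N_eq[OF V(1)[OF a] N_smooth[OF V(1)[OF b] V(1)[OF abc(3)]] p] eq[OF p] a b abc
      by (simp add: V \<gamma>)
  qed
  define m where "m = mm_part (comm a b)"
  have m: "m \<in> mm" "m \<in> su3" "mm_part m = m"
    unfolding m_def using mm_comm abc mm_subset_su3 by auto
  have m': "mm_part (comm b a) = - m"
    by (simp add: m_def swap[of b] lin)
  \<comment> \<open>The sign reflects that fundamental fields of a left action form an
    anti-homomorphic image of the Lie algebra.\<close>
  have "lie_bracket (V a) (V b) p = - m"
    unfolding lie_bracket_eq[OF V(1)[OF abc(1)] V(1)[OF abc(2)] p]
    by (simp add: V abc dV m' flip: m_def)
  then have NB: "N (lie_bracket (V a) (V b)) (V c) p = mm_part (comm c (- m)) + L (- m) c"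
    using N_eq[OF lie_bracket_smooth[OF V(1)[OF abc(1)] V(1)[OF abc(2)]] V(1)[OF abc(3)] p]
      dV[of "- m" c] subspace_neg[OF subspace_su3 m(2)] V(2)[OF abc(3)] by simp
  have jac: "comm (comm c a) b = comm (comm c b) a - comm (comm a b) c"
    by (simp add: comm_def mm.diff_left mm.diff_right matrix_mul_assoc algebra_simps)
  have "N (V a) (N (V b) (V c)) p - N (V b) (N (V a) (V c)) p - N (lie_bracket (V a) (V b)) (V c) p
    = L a (L b c) - L b (L a c) - L m c - mm_part (comm (comm a b - m) c)"
    unfolding NN[OF abc(1,2)] NN[OF abc(2,1)] NB m' jac
    by (simp add: lin L.add_right L.minus_left L.minus_right L.diff_left L.diff_right L.add_left
        cm.minus_left cm.minus_right cm.diff_left swap[of c m] m flip: m_def)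
  then show ?thesis
    unfolding curvature_at_def curvature_def V_def[symmetric] by (simp add: V abc m_def)
qed

end


subsection \<open>Traces over orthonormal frames\<close>

text \<open>Frames are indexed by natural numbers; the bijection \<open>h\<close> transports the
  statement to square matrices over a finite index type, where one-sided inverses are
  two-sided.\<close>

lemma left_right_inverse_nat:
  fixes A B :: "nat \<Rightarrow> nat \<Rightarrow> 'a::field" and h :: "'n::finite \<Rightarrow> nat"
  assumes h: "bij_betw h UNIV {..<n}"
    and AB: "\<And>i j. i < n \<Longrightarrow> j < n \<Longrightarrow> (\<Sum>k<n. A i k * B k j) = (if i = j then 1 else 0)"
    and ij: "i < n" "j < n"
  shows "(\<Sum>k<n. B i k * A k j) = (if i = j then 1 else 0)"
proof -
  have lt: "h k < n" for k using h by (auto simp: bij_betw_def)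
  have inj: "h k = h l \<longleftrightarrow> k = l" for k l using h by (auto simp: bij_betw_def inj_def)
  have sum: "(\<Sum>k\<in>UNIV. f (h k)) = (\<Sum>k<n. f k)" for f :: "nat \<Rightarrow> 'a"
    by (rule sum.reindex_bij_betw[OF h])
  define A' :: "'a^'n^'n" where "A' = (\<chi> k l. A (h k) (h l))"
  define B' :: "'a^'n^'n" where "B' = (\<chi> k l. B (h k) (h l))"
  have "A' ** B' = mat 1"
    by (simp add: A'_def B'_def matrix_matrix_mult_def mat_def vec_eq_iff AB lt inj
        sum[of "\<lambda>k. A (h _) k * B k (h _)"])
  then have BA: "B' ** A' = mat 1" using matrix_left_right_inverse by blast
  obtain k l where kl: "i = h k" "j = h l"
    using ij h by (metis bij_betw_def imageE lessThan_iff)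
  have "(B' ** A') $ k $ l = (\<Sum>k<n. B i k * A k j)"
    by (simp add: A'_def B'_def matrix_matrix_mult_def kl sum[of "\<lambda>k. B (h _) k * A k (h _)"])
  then show ?thesis using BA by (simp add: mat_def kl inj)
qed

lemma left_right_inverse_3:
  fixes A B :: "nat \<Rightarrow> nat \<Rightarrow> 'a::field"
  assumes "\<And>i j. i < 3 \<Longrightarrow> j < 3 \<Longrightarrow> (\<Sum>k<3. A i k * B k j) = (if i = j then 1 else 0)" "i < 3" "j < 3"
  shows "(\<Sum>k<3. B i k * A k j) = (if i = j then 1 else 0)"
proof -
  obtain h :: "3 \<Rightarrow> nat" where "bij_betw h UNIV {..<3}"
    using finite_same_card_bij[of "UNIV :: 3 set" "{..<3::nat}"] by auto
  then show ?thesis using left_right_inverse_nat[of h 3 A B] assms by blast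
qed

lemma left_right_inverse_6:
  fixes A B :: "nat \<Rightarrow> nat \<Rightarrow> 'a::field"
  assumes "\<And>i j. i < 6 \<Longrightarrow> j < 6 \<Longrightarrow> (\<Sum>k<6. A i k * B k j) = (if i = j then 1 else 0)" "i < 6" "j < 6"
  shows "(\<Sum>k<6. B i k * A k j) = (if i = j then 1 else 0)"
proof -
  obtain h :: "6 \<Rightarrow> nat" where "bij_betw h UNIV {..<6}"
    using finite_same_card_bij[of "UNIV :: 6 set" "{..<6::nat}"] by auto
  then show ?thesis using left_right_inverse_nat[of h 6 A B] assms by blast
qed

text \<open>A real basis of \<open>mm\<close>, orthogonal for every invariant metric. It is left
  unnormalised, which keeps square roots out of the traces.\<close>

definition bv :: "nat \<Rightarrow> mat3" where
  "bv k = [mk 1 0 0, mk \<i> 0 0, mk 0 1 0, mk 0 \<i> 0, mk 0 0 1, mk 0 0 \<i>] ! k"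

definition bv_sqnorm :: "real \<Rightarrow> real \<Rightarrow> real \<Rightarrow> nat \<Rightarrow> real" where
  "bv_sqnorm x y z k = [12 * x, 12 * x, 12 * y, 12 * y, 12 * z, 12 * z] ! k"

lemma less_6_cases: "k < (6::nat) \<Longrightarrow> k = 0 \<or> k = 1 \<or> k = 2 \<or> k = 3 \<or> k = 4 \<or> k = 5"
  by auto

lemma sum_lessThan_6: "(\<Sum>k<6. f k) = f 0 + f 1 + f 2 + f 3 + f 4 + f (5::nat)"
  by (simp add: eval_nat_numeral)

lemma bv_simps: "bv 0 = mk 1 0 0" "bv 1 = mk \<i> 0 0" "bv 2 = mk 0 1 0" "bv 3 = mk 0 \<i> 0"
  "bv 4 = mk 0 0 1" "bv 5 = mk 0 0 \<i>"
  by (simp_all add: bv_def)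

lemma bv_sqnorm_simps: "bv_sqnorm x y z 0 = 12 * x" "bv_sqnorm x y z 1 = 12 * x"
  "bv_sqnorm x y z 2 = 12 * y" "bv_sqnorm x y z 3 = 12 * y"
  "bv_sqnorm x y z 4 = 12 * z" "bv_sqnorm x y z 5 = 12 * z"
  by (simp_all add: bv_sqnorm_def)

lemma bv_mm: "k < 6 \<Longrightarrow> bv k \<in> mm"
  by (drule less_6_cases) (elim disjE; simp add: bv_simps del: One_nat_def)

lemma bv_metric:
  assumes "k < 6" "l < 6"
  shows "inv_metric x y z (bv k) (bv l) = (if k = l then bv_sqnorm x y z k else 0)"
  using less_6_cases[OF assms(1)] less_6_cases[OF assms(2)]
  by (elim disjE) (simp_all add: bv_simps bv_sqnorm_simps inv_metric_mk del: One_nat_def)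

context flag_metric
begin

abbreviation "nv \<equiv> bv_sqnorm x y z"

lemma nv_pos: "k < 6 \<Longrightarrow> nv k > 0"
  using pos by (drule_tac less_6_cases) (elim disjE; simp add: bv_sqnorm_simps del: One_nat_def)

lemma mm_expand:
  assumes "X \<in> mm"
  shows "X = (\<Sum>k<6. (g X (bv k) / nv k) *\<^sub>R bv k)"
proof -
  obtain a b c where X: "X = mk a b c" using mm_cases[OF assms] .
  show ?thesis
    using pos by (simp add: X sum_lessThan_6 bv_simps bv_sqnorm_simps inv_metric_mk vec_eq_iff
        forall_3 complex_eq_iff del: One_nat_def)
qed

lemma orthonormal_frame_some_frame: "orthonormal_frame g (some_frame g)"
proof -
  interpret g: bounded_bilinear g by (rule bounded_bilinear_inv_metric)
  have "orthonormal_frame g (\<lambda>k. (1 / sqrt (nv k)) *\<^sub>R bv k)"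
    unfolding orthonormal_frame_def
  proof (intro conjI allI impI)
    fix i j :: nat assume ij: "i < 6" "j < 6"
    show "(1 / sqrt (nv i)) *\<^sub>R bv i \<in> mm"
      using subspace_scale[OF subspace_mm bv_mm[OF ij(1)]] .
    show "g ((1 / sqrt (nv i)) *\<^sub>R bv i) ((1 / sqrt (nv j)) *\<^sub>R bv j) = (if i = j then 1 else 0)"
      using nv_pos[OF ij(1)] nv_pos[OF ij(2)] by (simp add: g.scaleR_left g.scaleR_right bv_metric[OF ij])
  qed
  then show ?thesis unfolding some_frame_def by (rule someI[of "orthonormal_frame g"])
qed

text \<open>The trace of a bilinear form is the same in every orthonormal frame; this replaces the
  arbitrary \<open>some_frame\<close> by the explicit basis.\<close>

lemma frame_trace:
  assumes e: "orthonormal_frame g e" and h: "bilinear h"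
  shows "(\<Sum>i<6. h (e i) (e i)) = (\<Sum>k<6. h (bv k) (bv k) / nv k :: real)"
proof -
  interpret g: bounded_bilinear g by (rule bounded_bilinear_inv_metric)
  interpret h: bounded_bilinear h using h by (simp add: bilinear_conv_bounded_bilinear)
  \<comment> \<open>\<open>A\<close> holds the inner products of the frame with the basis and
    \<open>B\<close> the coordinates of the frame. Orthonormality says \<open>A\<close> times
    \<open>B\<close> is the identity; the reversed product yields \<open>BB\<close>.\<close>
  define A where "A = (\<lambda>i k. g (e i) (bv k))"
  define B where "B = (\<lambda>k i. g (e i) (bv k) / nv k)"
  have e_mm: "e i \<in> mm" if "i < 6" for i using e that by (simp add: orthonormal_frame_def)
  have ex: "e i = (\<Sum>k<6. B k i *\<^sub>R bv k)" if "i < 6" for i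
    using mm_expand[OF e_mm[OF that]] by (simp add: B_def)
  have AB: "(\<Sum>k<6. A i k * B k j) = (if i = j then 1 else 0)" if "i < 6" "j < 6" for i j
  proof -
    have "(\<Sum>k<6. A i k * B k j) = g (e i) (\<Sum>k<6. B k j *\<^sub>R bv k)"
      by (simp add: g.sum_right g.scaleR_right A_def mult.commute)
    also have "\<dots> = g (e i) (e j)" using ex[OF that(2)] by simp
    finally show ?thesis using e that by (simp add: orthonormal_frame_def)
  qed
  have BB: "(\<Sum>i<6. B k i * B l i) = (if k = l then 1 / nv k else 0)" if "k < 6" "l < 6" for k l
  proof -
    have "(\<Sum>i<6. B k i * B l i) = (\<Sum>i<6. B k i * A i l) / nv l"
      by (simp add: sum_divide_distrib A_def B_def)
    then show ?thesis using left_right_inverse_6[OF AB that] by simp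
  qed
  have "(\<Sum>i<6. h (e i) (e i)) = (\<Sum>i<6. \<Sum>k<6. \<Sum>l<6. (B k i * B l i) * h (bv k) (bv l))"
  proof (rule sum.cong[OF refl])
    fix i :: nat assume "i \<in> {..<6}"
    then have "h (e i) (e i) = h (\<Sum>k<6. B k i *\<^sub>R bv k) (\<Sum>l<6. B l i *\<^sub>R bv l)"
      using ex by simp
    also have "\<dots> = (\<Sum>l<6. \<Sum>k<6. (B k i * B l i) * h (bv k) (bv l))"
      by (simp add: h.sum_left h.sum_right h.scaleR_left h.scaleR_right sum_distrib_left mult_ac)
    finally show "h (e i) (e i) = (\<Sum>k<6. \<Sum>l<6. (B k i * B l i) * h (bv k) (bv l))"
      by (subst (asm) sum.swap)
  qed
  also have "\<dots> = (\<Sum>k<6. \<Sum>i<6. \<Sum>l<6. (B k i * B l i) * h (bv k) (bv l))"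
    by (rule sum.swap)
  also have "\<dots> = (\<Sum>k<6. \<Sum>l<6. \<Sum>i<6. (B k i * B l i) * h (bv k) (bv l))"
    by (intro sum.cong refl sum.swap)
  also have "\<dots> = (\<Sum>k<6. \<Sum>l<6. (if k = l then 1 / nv k else 0) * h (bv k) (bv l))"
    by (intro sum.cong refl) (simp add: BB flip: sum_distrib_right)
  also have "\<dots> = (\<Sum>k<6. h (bv k) (bv k) / nv k)"
    by (intro sum.cong refl) (simp add: if_distrib if_distribR cong: if_cong)
  finally show ?thesis .
qed

subsection \<open>The Riemannian scalar curvature\<close>

definition torus_act :: "mat3 \<Rightarrow> mat3 \<Rightarrow> mat3 \<Rightarrow> mat3" where
  "torus_act a b c = mm_part (comm (comm a b - mm_part (comm a b)) c)"

text \<open>The Levi-Civita curvature as an algebraic tensor, defined on all matrices so that its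
  linearity needs no membership conditions.\<close>

definition Rm :: "mat3 \<Rightarrow> mat3 \<Rightarrow> mat3 \<Rightarrow> mat3 \<Rightarrow> real" where
  "Rm a b c d = - g (\<Lambda> a (\<Lambda> b c) - \<Lambda> b (\<Lambda> a c) - \<Lambda> (mm_part (comm a b)) c
    - torus_act a b c) d"

lemma curvature_at_D:
  assumes "p \<in> SU3" "a \<in> mm" "b \<in> mm" "c \<in> mm" "d \<in> mm"
  shows "curvature_at g D p a b c d = Rm a b c d"
  unfolding Rm_def torus_act_def
  by (rule curvature_at_eq[OF bounded_bilinear_nomizu D_smooth D_eq assms])

text \<open>These are the pairs of slots contracted in the scalar curvature, one for each use of
  \<open>frame_trace\<close>.\<close>

lemma bilinear_Rm: "bilinear (\<lambda>b d. Rm a b c d)" "bilinear (\<lambda>a c. Rm a b c d)"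
proof -
  interpret g: bounded_bilinear g by (rule bounded_bilinear_inv_metric)
  interpret L: bounded_bilinear \<Lambda> by (rule bounded_bilinear_nomizu)
  interpret cm: bounded_bilinear comm by (rule bounded_bilinear_comm)
  note lin = linear_add[OF linear_mm_part] linear_diff[OF linear_mm_part] linear_scale[OF linear_mm_part]
    g.add_left g.add_right g.scaleR_left g.scaleR_right g.diff_left
    L.add_left L.add_right L.scaleR_left L.scaleR_right
    cm.add_left cm.add_right cm.scaleR_left cm.scaleR_right cm.diff_left
  show "bilinear (\<lambda>b d. Rm a b c d)" "bilinear (\<lambda>a c. Rm a b c d)"
    by (rule bilinear_intro; simp add: Rm_def torus_act_def lin algebra_simps)+
qed

lemma torus_act_mk:
  "torus_act (mk a b c) (mk a' b' c') (mk u v w) =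
    (let h1 = a' * cnj a - a * cnj a' + c' * cnj c - c * cnj c';
         h2 = a * cnj a' - a' * cnj a + b' * cnj b - b * cnj b';
         h3 = c * cnj c' - c' * cnj c + b * cnj b' - b' * cnj b in
     mk ((h1 - h2) * u) ((h2 - h3) * v) ((h1 - h3) * w))"
  by (simp add: vec_eq_iff forall_3 Let_def torus_act_def comm_nth matrix_mult_nth algebra_simps)

text \<open>The coordinate planes of \<open>bv\<close>. In the mixed planes the value is the same
  for all choices of units because the torus rotates any two of the three summands
  independently.\<close>

lemma Rm_planes:
  assumes "a = 1 \<or> a = \<i>" "b = 1 \<or> b = \<i>"
  shows "Rm (mk a 0 0) (mk b 0 0) (mk a 0 0) (mk b 0 0) = (if a = b then 0 else 48 * x)"
    and "Rm (mk 0 a 0) (mk 0 b 0) (mk 0 a 0) (mk 0 b 0) = (if a = b then 0 else 48 * y)"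
    and "Rm (mk 0 0 a) (mk 0 0 b) (mk 0 0 a) (mk 0 0 b) = (if a = b then 0 else 48 * z)"
    and "Rm (mk a 0 0) (mk 0 b 0) (mk a 0 0) (mk 0 b 0) = 3 * (2 * z * (x + y) - 3 * z\<^sup>2 + (x - y)\<^sup>2) / z"
    and "Rm (mk 0 a 0) (mk b 0 0) (mk 0 a 0) (mk b 0 0) = 3 * (2 * z * (x + y) - 3 * z\<^sup>2 + (x - y)\<^sup>2) / z"
    and "Rm (mk a 0 0) (mk 0 0 b) (mk a 0 0) (mk 0 0 b) = 3 * (2 * y * (x + z) - 3 * y\<^sup>2 + (x - z)\<^sup>2) / y"
    and "Rm (mk 0 0 a) (mk b 0 0) (mk 0 0 a) (mk b 0 0) = 3 * (2 * y * (x + z) - 3 * y\<^sup>2 + (x - z)\<^sup>2) / y"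
    and "Rm (mk 0 a 0) (mk 0 0 b) (mk 0 a 0) (mk 0 0 b) = 3 * (2 * x * (y + z) - 3 * x\<^sup>2 + (y - z)\<^sup>2) / x"
    and "Rm (mk 0 0 a) (mk 0 b 0) (mk 0 0 a) (mk 0 b 0) = 3 * (2 * x * (y + z) - 3 * x\<^sup>2 + (y - z)\<^sup>2) / x"
  using assms pos
  unfolding Rm_def torus_act_mk Let_def mm_comm_mk nomizu_mk mk_diff inv_metric_mk
  by (elim disjE; hypsubst; simp; simp add: field_simps power2_eq_square)+

lemma scalar_curvature_eq:
  assumes p: "p \<in> SU3"
  shows "scalar_curvature g D p = (6 * (x * y + y * z + z * x) - (x\<^sup>2 + y\<^sup>2 + z\<^sup>2)) / (6 * x * y * z)"
proof -
  let ?e = "some_frame g"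
  note e = orthonormal_frame_some_frame
  have "scalar_curvature g D p = (\<Sum>i<6. \<Sum>j<6. Rm (?e i) (?e j) (?e i) (?e j))"
    unfolding scalar_curvature_def
    by (intro sum.cong refl curvature_at_D[OF p]) (use e in \<open>auto simp: orthonormal_frame_def\<close>)
  also have "\<dots> = (\<Sum>i<6. \<Sum>l<6. Rm (?e i) (bv l) (?e i) (bv l) / nv l)"
    by (intro sum.cong refl frame_trace[OF e bilinear_Rm(1)])
  also have "\<dots> = (\<Sum>l<6. (\<Sum>i<6. Rm (?e i) (bv l) (?e i) (bv l)) / nv l)"
    by (subst sum.swap) (simp add: sum_divide_distrib)
  also have "\<dots> = (\<Sum>l<6. (\<Sum>k<6. Rm (bv k) (bv l) (bv k) (bv l) / nv k) / nv l)"
    by (simp add: frame_trace[OF e bilinear_Rm(2)])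
  finally have s: "scalar_curvature g D p = (\<Sum>l<6. (\<Sum>k<6. Rm (bv k) (bv l) (bv k) (bv l) / nv k) / nv l)" .
  show ?thesis
    using pos unfolding s sum_lessThan_6 bv_simps bv_sqnorm_simps
    by (simp add: Rm_planes) (simp add: field_simps power2_eq_square)
qed

end


subsection \<open>Invariant almost complex structures\<close>

lemma sign_choice_swap: "sign_choice \<epsilon> \<Longrightarrow> i \<noteq> j \<Longrightarrow> \<epsilon> j i = - \<epsilon> i j"
  unfolding sign_choice_def by blast

lemma sign_choice_cases:
  assumes "sign_choice \<epsilon>"
  shows "\<epsilon> 1 2 = 1 \<or> \<epsilon> 1 2 = - 1" "\<epsilon> 2 3 = 1 \<or> \<epsilon> 2 3 = - 1" "\<epsilon> 1 3 = 1 \<or> \<epsilon> 1 3 = - 1"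
proof -
  have "\<epsilon> i j = 1 \<or> \<epsilon> i j = - 1" if "i \<noteq> j" for i j
    using assms that unfolding sign_choice_def by blast
  then show "\<epsilon> 1 2 = 1 \<or> \<epsilon> 1 2 = - 1" "\<epsilon> 2 3 = 1 \<or> \<epsilon> 2 3 = - 1" "\<epsilon> 1 3 = 1 \<or> \<epsilon> 1 3 = - 1"
    by simp_all
qed

lemma inv_acs_mk:
  assumes "sign_choice \<epsilon>"
  shows "inv_acs \<epsilon> (mk a b c) = mk (\<i> * of_real (\<epsilon> 1 2) * a) (\<i> * of_real (\<epsilon> 2 3) * b) (\<i> * of_real (\<epsilon> 1 3) * c)"
proof -
  have "\<epsilon> 2 1 = - \<epsilon> 1 2" "\<epsilon> 3 2 = - \<epsilon> 2 3" "\<epsilon> 3 1 = - \<epsilon> 1 3"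
    by (rule sign_choice_swap[OF assms]; simp)+
  then show ?thesis by (simp add: vec_eq_iff forall_3)
qed

lemma inv_acs_mm: "sign_choice \<epsilon> \<Longrightarrow> X \<in> mm \<Longrightarrow> inv_acs \<epsilon> X \<in> mm"
  by (elim mm_cases) (simp add: inv_acs_mk)

lemma inv_acs_inv_acs:
  assumes "sign_choice \<epsilon>" "X \<in> mm"
  shows "inv_acs \<epsilon> (inv_acs \<epsilon> X) = - X"
proof -
  have sq: "\<epsilon> 1 2 * \<epsilon> 1 2 = 1" "\<epsilon> 2 3 * \<epsilon> 2 3 = 1" "\<epsilon> 1 3 * \<epsilon> 1 3 = 1"
    using sign_choice_cases[OF assms(1)] by auto
  then have "complex_of_real (\<epsilon> 1 2) * of_real (\<epsilon> 1 2) = 1" "complex_of_real (\<epsilon> 2 3) * of_real (\<epsilon> 2 3) = 1"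
    "complex_of_real (\<epsilon> 1 3) * of_real (\<epsilon> 1 3) = 1"
    by (metis of_real_mult of_real_1)+
  then have c: "\<i> * of_real (\<epsilon> 1 2) * (\<i> * of_real (\<epsilon> 1 2) * a) = - a"
    "\<i> * of_real (\<epsilon> 2 3) * (\<i> * of_real (\<epsilon> 2 3) * a) = - a"
    "\<i> * of_real (\<epsilon> 1 3) * (\<i> * of_real (\<epsilon> 1 3) * a) = - a" for a
    by (simp_all add: mult_ac)
  obtain a b d where X: "X = mk a b d" using mm_cases[OF assms(2)] .
  show ?thesis unfolding X inv_acs_mk[OF assms(1)] c by (simp add: vec_eq_iff forall_3)
qed

lemma smooth_vfield_inv_acs:
  assumes \<epsilon>: "sign_choice \<epsilon>" and X: "smooth_vfield X"
  shows "smooth_vfield (inv_acs \<epsilon> \<circ> X)"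
proof -
  have "inv_acs \<epsilon> (herm_adj t ** A ** t) = herm_adj t ** inv_acs \<epsilon> A ** t" if "t \<in> torus" for t A
    by (rule mat3_eqI) (simp add: torus_conj_nth[OF that])
  then show ?thesis
    using smooth_compose_linear[OF bounded_linear_inv_acs vfieldD(1)[OF X]] vfieldD(2,4)[OF X]
      inv_acs_mm[OF \<epsilon>] by (simp add: smooth_vfield_def o_def)
qed

lemma left_deriv_inv_acs:
  assumes "smooth_vfield X" "p \<in> SU3" "v \<in> su3"
  shows "left_deriv (inv_acs \<epsilon> \<circ> X) p v = inv_acs \<epsilon> (left_deriv X p v)"
  unfolding o_def
  by (rule left_deriv_compose_linear[OF bounded_linear_inv_acs vfieldD(5)[OF assms(1,2)] assms(2,3)])

lemma inv_metric_inv_acs: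
  assumes "sign_choice \<epsilon>" "X \<in> mm" "Y \<in> mm"
  shows "inv_metric x y z (inv_acs \<epsilon> X) Y = - inv_metric x y z X (inv_acs \<epsilon> Y)"
proof -
  obtain a b c a' b' c' where XY: "X = mk a b c" "Y = mk a' b' c'"
    using assms(2,3) by (elim mm_cases)
  show ?thesis unfolding XY inv_acs_mk[OF assms(1)] inv_metric_mk
    by (simp add: algebra_simps)
qed

text \<open>On \<open>\<gg>\<^sub>i\<^sub>j \<times> \<gg>\<^sub>j\<^sub>k\<close> the Nijenhuis tensor is the bracket times
  \<open>1 + \<epsilon>\<^sub>i\<^sub>j \<epsilon>\<^sub>j\<^sub>k - \<epsilon>\<^sub>i\<^sub>k (\<epsilon>\<^sub>i\<^sub>j + \<epsilon>\<^sub>j\<^sub>k)\<close>, which vanishes unless \<open>\<epsilon>\<^sub>i\<^sub>j = \<epsilon>\<^sub>j\<^sub>k = - \<epsilon>\<^sub>i\<^sub>k\<close>.\<close>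

lemma nijenhuis_algebraic:
  assumes \<epsilon>: "sign_choice \<epsilon>" "\<not> (\<epsilon> 1 2 = \<epsilon> 2 3 \<and> \<epsilon> 1 3 = - \<epsilon> 1 2)" and XY: "X \<in> mm" "Y \<in> mm"
  shows "mm_part (comm X Y) - mm_part (comm (inv_acs \<epsilon> X) (inv_acs \<epsilon> Y))
    + inv_acs \<epsilon> (mm_part (comm (inv_acs \<epsilon> X) Y)) + inv_acs \<epsilon> (mm_part (comm X (inv_acs \<epsilon> Y))) = 0"
proof -
  obtain a b c a' b' c' where XY: "X = mk a b c" "Y = mk a' b' c'"
    using XY by (elim mm_cases)
  show ?thesis
    \<comment> \<open>Six of the eight sign patterns remain; in each, the factor of every bracket is
      zero.\<close>
    using sign_choice_cases[OF \<epsilon>(1)] \<epsilon>(2)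
    unfolding XY inv_acs_mk[OF \<epsilon>(1)] mm_comm_mk mk_diff mk_add
    by (elim disjE) (simp_all add: algebra_simps)
qed

context flag_metric
begin

text \<open>As \<open>J\<close> is constant with square -1, all derivative terms cancel and the
  algebraic Nijenhuis expression is left. The contrapositive extracts the signs of a non-integrable
  structure.\<close>

lemma integrable_inv_acs:
  assumes \<epsilon>: "sign_choice \<epsilon>" "\<not> (\<epsilon> 1 2 = \<epsilon> 2 3 \<and> \<epsilon> 1 3 = - \<epsilon> 1 2)"
  shows "integrable_acs (inv_acs \<epsilon>)"
  unfolding integrable_acs_def
proof (intro allI impI ballI)
  fix X Y p assume "smooth_vfield X \<and> smooth_vfield Y" and p: "p \<in> SU3"
  then have X: "smooth_vfield X" and Y: "smooth_vfield Y" by auto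
  let ?J = "inv_acs \<epsilon>"
  note JX = smooth_vfield_inv_acs[OF \<epsilon>(1) X] and JY = smooth_vfield_inv_acs[OF \<epsilon>(1) Y]
  note v = vfieldD(3)[OF X p] vfieldD(3)[OF Y p] vfieldD(3)[OF JX p] vfieldD(3)[OF JY p]
  have JJ: "?J (?J (left_deriv X p (Y p))) = - left_deriv X p (Y p)"
    "?J (?J (left_deriv Y p (X p))) = - left_deriv Y p (X p)"
    using inv_acs_inv_acs[OF \<epsilon>(1)] vfieldD(6)[OF X p v(2)] vfieldD(6)[OF Y p v(1)] by auto
  note lin = linear_add[OF linear_inv_acs] linear_diff[OF linear_inv_acs]
  show "nijenhuis ?J X Y p = 0"
    using nijenhuis_algebraic[OF \<epsilon> vfieldD(2)[OF X p] vfieldD(2)[OF Y p]] v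
    unfolding nijenhuis_def lie_bracket_eq[OF X Y p] lie_bracket_eq[OF JX Y p] lie_bracket_eq[OF X JY p]
      lie_bracket_eq[OF JX JY p]
    by (simp add: left_deriv_inv_acs[OF X p] left_deriv_inv_acs[OF Y p] lin JJ algebra_simps)
qed

end

section \<open>Structures whose signs at 12, 23 and 31 agree\<close>

locale cyclic_acs = flag_metric +
  fixes \<epsilon> :: "3 \<Rightarrow> 3 \<Rightarrow> real"
  assumes sign: "sign_choice \<epsilon>" and cyclic: "\<epsilon> 1 2 = \<epsilon> 2 3" "\<epsilon> 1 3 = - \<epsilon> 1 2"
begin

abbreviation "J \<equiv> inv_acs \<epsilon>"

lemma J_mk: "J (mk a b c) = mk (\<i> * of_real (\<epsilon> 1 2) * a) (\<i> * of_real (\<epsilon> 1 2) * b) (- (\<i> * of_real (\<epsilon> 1 2) * c))"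
  using cyclic by (simp add: inv_acs_mk[OF sign])

lemmas J_mm = inv_acs_mm[OF sign]
lemmas J_J = inv_acs_inv_acs[OF sign]

lemma J_add: "J (a + b) = J a + J b"
  by (rule linear_add[OF linear_inv_acs])

lemma J_minus: "J (- a) = - J a"
  by (rule linear_neg[OF linear_inv_acs])

text \<open>The sum of two distinct (1,0) roots is a (0,1) root, and their difference is not a root.
  Hence brackets of (1,0) vectors are of type (0,1) and mixed brackets have no part in
  \<open>mm\<close>; real coefficients preserve this.\<close>

lemma nomizu_J:
  assumes "X \<in> mm" "Y \<in> mm"
  shows "\<Lambda> (J X) Y = - J (\<Lambda> X Y)" "\<Lambda> X (J Y) = - J (\<Lambda> X Y)"
proof -
  obtain a b c a' b' c' where XY: "X = mk a b c" "Y = mk a' b' c'"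
    using assms by (elim mm_cases)
  show "\<Lambda> (J X) Y = - J (\<Lambda> X Y)" "\<Lambda> X (J Y) = - J (\<Lambda> X Y)"
    unfolding XY J_mk nomizu_mk mk_minus mk_eq_iff
    by (simp_all add: algebra_simps del: of_real_add of_real_diff of_real_divide)
qed

lemma comm_J:
  assumes "X \<in> mm" "Y \<in> mm"
  shows "mm_part (comm (J X) Y) = - J (mm_part (comm X Y))" "mm_part (comm X (J Y)) = - J (mm_part (comm X Y))"
proof -
  obtain a b c a' b' c' where XY: "X = mk a b c" "Y = mk a' b' c'"
    using assms by (elim mm_cases)
  show "mm_part (comm (J X) Y) = - J (mm_part (comm X Y))" "mm_part (comm X (J Y)) = - J (mm_part (comm X Y))"
    unfolding XY J_mk mm_comm_mk mk_minus mk_eq_iff by (simp_all add: algebra_simps)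
qed

subsection \<open>The Chern connection\<close>

lemma smooth_J: "smooth_vfield X \<Longrightarrow> smooth_vfield (J \<circ> X)"
  by (rule smooth_vfield_inv_acs[OF sign])

lemma cov_J_eq:
  assumes X: "smooth_vfield X" and Z: "smooth_vfield Z" and p: "p \<in> SU3"
  shows "cov_J D J X Z p = - 2 *\<^sub>R J (\<Lambda> (X p) (Z p))"
  unfolding cov_J_def D_eq[OF X smooth_J[OF Z] p] D_eq[OF X Z p] left_deriv_inv_acs[OF Z p vfieldD(3)[OF X p]]
  by (simp add: nomizu_J vfieldD(2)[OF X p] vfieldD(2)[OF Z p] J_add scaleR_2)

text \<open>Antilinearity in the first slot makes the two summands cancel; the terms of the
  Gauduchon connection containing \<open>t\<close> thus vanish.\<close>

lemma cov_J_JJ_eq: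
  assumes Y: "smooth_vfield Y" and X: "smooth_vfield X" and p: "p \<in> SU3"
  shows "cov_J_JJ D J Y X p = 0"
proof -
  have mm: "X p \<in> mm" "Y p \<in> mm" using vfieldD(2) X Y p by auto
  have L: "\<Lambda> (Y p) (X p) \<in> mm" using nomizu_mm mm by blast
  show ?thesis
    unfolding cov_J_JJ_def cov_J_eq[OF smooth_J[OF Y] X p] cov_J_eq[OF Y X p]
    by (simp add: nomizu_J mm J_minus J_J L linear_scale[OF linear_inv_acs])
qed

text \<open>\<open>\<Lambda>(X)\<close> anticommutes with \<open>J\<close>, so the Chern connection is the canonical connection of the
  homogeneous space.\<close>

lemma gauduchon_eq:
  assumes X: "smooth_vfield X" and Z: "smooth_vfield Z" and p: "p \<in> SU3"
  shows "gauduchon g J D t X Z p = left_deriv Z p (X p)"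
proof -
  interpret g: bounded_bilinear g by (rule bounded_bilinear_inv_metric)
  have mm: "X p \<in> mm" "Z p \<in> mm" using vfieldD(2) X Z p by auto
  have L: "\<Lambda> (X p) (Z p) \<in> mm" using nomizu_mm mm by blast
  have d: "left_deriv Z p (X p) \<in> mm" using vfieldD(6)[OF Z p vfieldD(3)[OF X p]] .
  \<comment> \<open>The term with factor 1/2 contributes exactly minus the Nomizu part of
    \<open>D\<close>, since \<open>J\<close> squares to -1.\<close>
  have eq: "g (D X Z p) (Y p) - 1/2 * g (J (cov_J D J X Z p)) (Y p)
       + t/4 * g (cov_J_JJ D J Y X p) (Z p) - t/4 * g (cov_J_JJ D J Z X p) (Y p)
    = g (left_deriv Z p (X p)) (Y p)" if Y: "smooth_vfield Y" for Y
    unfolding cov_J_JJ_eq[OF Y X p] cov_J_JJ_eq[OF Z X p] cov_J_eq[OF X Z p] D_eq[OF X Z p]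
    by (simp add: linear_scale[OF linear_inv_acs] J_minus J_J L g.zero_left g.add_left g.scaleR_left g.minus_left)
  show ?thesis
    unfolding gauduchon_def
  proof (rule the_equality)
    show "left_deriv Z p (X p) \<in> mm \<and> (\<forall>Y. smooth_vfield Y \<longrightarrow> g (left_deriv Z p (X p)) (Y p)
      = g (D X Z p) (Y p) - 1/2 * g (J (cov_J D J X Z p)) (Y p)
       + t/4 * g (cov_J_JJ D J Y X p) (Z p) - t/4 * g (cov_J_JJ D J Z X p) (Y p))"
      using d eq by simp
  next
    fix v assume v: "v \<in> mm \<and> (\<forall>Y. smooth_vfield Y \<longrightarrow> g v (Y p)
      = g (D X Z p) (Y p) - 1/2 * g (J (cov_J D J X Z p)) (Y p)
       + t/4 * g (cov_J_JJ D J Y X p) (Z p) - t/4 * g (cov_J_JJ D J Z X p) (Y p))"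
    show "v = left_deriv Z p (X p)"
    proof (rule metric_nondegenerate[OF _ d])
      show "v \<in> mm" using v by simp
      fix a assume a: "a \<in> mm"
      note E = smooth_vfield_extend[OF a, of p] extend_at_base[OF p a]
      have "g v (extend p a p) = g (left_deriv Z p (X p)) (extend p a p)"
        using v E(1) eq[OF E(1)] by simp
      then show "g v a = g (left_deriv Z p (X p)) a" by (simp add: E(2))
    qed
  qed
qed

lemma gauduchon_smooth:
  assumes X: "smooth_vfield X" and Z: "smooth_vfield Z"
  shows "smooth_vfield (gauduchon g J D t X Z)"
proof (rule smooth_vfield_cong)
  \<comment> \<open>The connection is given pointwise by a description, so its smoothness is
    inherited from this difference.\<close>
  show "smooth_vfield (\<lambda>q. D X Z q - \<Lambda> (X q) (Z q))"
    by (rule smooth_vfield_diff[OF D_smooth[OF X Z]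
        smooth_vfield_bilinear[OF bounded_bilinear_nomizu X Z nomizu_mm nomizu_equivariant]])
qed (simp add: gauduchon_eq[OF X Z] D_eq[OF X Z])

text \<open>The canonical connection has Nomizu map zero, which leaves only the torus term.\<close>

lemma curvature_at_gauduchon:
  assumes "p \<in> SU3" "a \<in> mm" "b \<in> mm" "c \<in> mm" "d \<in> mm"
  shows "curvature_at g (gauduchon g J D t) p a b c d = g (torus_act a b c) d"
proof -
  interpret g: bounded_bilinear g by (rule bounded_bilinear_inv_metric)
  have 0: "bounded_bilinear (\<lambda>_ _. 0 :: mat3)"
    by (rule bounded_bilinear.intro) (auto intro: exI[of _ 0])
  have "curvature_at g (gauduchon g J D t) p a b c d = - g (0 - 0 - 0 - torus_act a b c) d"
    unfolding torus_act_def
    by (rule curvature_at_eq[OF 0 gauduchon_smooth _ assms]) (simp_all add: gauduchon_eq)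
  then show ?thesis by (simp add: g.minus_left)
qed

end


subsection \<open>Complex linear extension\<close>

lemma mm_complex_iff: "Z \<in> mm_complex \<longleftrightarrow> (\<forall>i. Z $ i $ i = 0)"
  and mre_mm: "Z \<in> mm_complex \<Longrightarrow> mre Z \<in> mm"
  and mim_mm: "Z \<in> mm_complex \<Longrightarrow> mim Z \<in> mm"
proof -
  have skew: "herm_adj (mre Z) = - mre Z" "herm_adj (mim Z) = - mim Z"
    by (rule mat3_eqI; simp add: mre_def mim_def mconj_def field_simps)+
  have 1: "Z $ i $ i = 0" if "Z \<in> mm_complex" for i
    using that by (auto simp: mm_complex_def mm_iff)
  have 2: "mre Z \<in> mm" "mim Z \<in> mm" if "\<forall>i. Z $ i $ i = 0"
    using that skew by (simp_all add: mm_iff mre_def mim_def mconj_def)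
  have "Z = mre Z + cscale \<i> (mim Z)"
    by (rule mat3_eqI) (simp add: mre_def mim_def mconj_def field_simps)
  then show "Z \<in> mm_complex \<longleftrightarrow> (\<forall>i. Z $ i $ i = 0)"
    using 1 2 unfolding mm_complex_def by blast
  show "Z \<in> mm_complex \<Longrightarrow> mre Z \<in> mm" "Z \<in> mm_complex \<Longrightarrow> mim Z \<in> mm"
    using 1 2 by blast+
qed

lemma mre_mim: "mre Z + cscale \<i> (mim Z) = Z"
  by (rule mat3_eqI) (simp add: mre_def mim_def mconj_def field_simps)

lemma mconj_mm_complex: "Z \<in> mm_complex \<Longrightarrow> mconj Z \<in> mm_complex"
  by (simp add: mm_complex_iff mconj_def)

text \<open>Replaces the iterated extension by an explicit complex linear expression
  \<open>F\<close> agreeing with \<open>f\<close> on \<open>mm\<close>.\<close>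

lemma cext_eq:
  assumes "\<And>a. a \<in> mm \<Longrightarrow> f a = F a" "\<And>A B. F (A + cscale \<i> B) = F A + \<i> * F B" "Z \<in> mm_complex"
  shows "cext f Z = F Z"
  using assms(1)[OF mre_mm[OF assms(3)]] assms(1)[OF mim_mm[OF assms(3)]] assms(2)[of "mre Z" "mim Z"]
  by (simp add: cext_def mre_mim)

lemma cext2_eq:
  assumes "\<And>a b. a \<in> mm \<Longrightarrow> b \<in> mm \<Longrightarrow> f a b = F a b"
    "\<And>A B C. F (A + cscale \<i> B) C = F A C + \<i> * F B C"
    "\<And>A B C. F C (A + cscale \<i> B) = F C A + \<i> * F C B"
    "Z \<in> mm_complex" "W \<in> mm_complex"
  shows "cext2 f Z W = F Z W"
  unfolding cext2_def by (intro cext_eq[where F = "\<lambda>a. F a W"] cext_eq assms)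

lemma metricC_linear:
  "metricC x y z (A + cscale \<i> B) C = metricC x y z A C + \<i> * metricC x y z B C"
  "metricC x y z C (A + cscale \<i> B) = metricC x y z C A + \<i> * metricC x y z C B"
  by (simp_all add: metricC_def algebra_simps)

lemma cext2_metric:
  assumes "Z \<in> mm_complex" "W \<in> mm_complex"
  shows "cext2 (\<lambda>a b. of_real (inv_metric x y z a b)) Z W = metricC x y z Z W"
  using assms by (intro cext2_eq) (simp_all add: inv_metric_mm metricC_linear)

text \<open>The trace of \<open>ad H\<close> on \<open>T\<^sup>1\<^sup>,\<^sup>0\<close> vanishes because the three roots of type \<open>(1,0)\<close> sum to zero.\<close>

lemma weighted_trace_zero:
  fixes w :: "nat \<Rightarrow> nat \<Rightarrow> complex" and r \<rho> :: "nat \<Rightarrow> complex"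
  assumes orth: "\<And>i j. i < 3 \<Longrightarrow> j < 3 \<Longrightarrow> (\<Sum>k<3. w i k * (r k * cnj (w j k))) = (if i = j then 1 else 0)"
    and \<rho>: "(\<Sum>k<3. \<rho> k) = 0"
  shows "(\<Sum>j<3. \<Sum>k<3. r k * (\<rho> k * w j k) * cnj (w j k)) = 0"
proof -
  have "(\<Sum>j<3. \<Sum>k<3. r k * (\<rho> k * w j k) * cnj (w j k))
    = (\<Sum>k<3. \<rho> k * (\<Sum>j<3. (r k * cnj (w j k)) * w j k))"
    by (subst sum.swap) (simp add: sum_distrib_left mult_ac)
  \<comment> \<open>Orthonormality of the rows of \<open>w\<close> is turned into completeness, so
    each inner sum equals one.\<close>
  also have "\<dots> = (\<Sum>k<3. \<rho> k)"
    by (intro sum.cong refl)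
      (use left_right_inverse_3[of w "\<lambda>k j. r k * cnj (w j k)", OF orth] in auto)
  finally show ?thesis using \<rho> by simp
qed

lemma sum_lessThan_3: "(\<Sum>k<3. f k) = f 0 + f 1 + f (2::nat)"
  by (simp add: eval_nat_numeral)

lemma less_3_cases: "k < (3::nat) \<Longrightarrow> k = 0 \<or> k = 1 \<or> k = 2"
  by auto

section \<open>Vanishing of the Chern scalar curvature\<close>

context cyclic_acs
begin

abbreviation "e \<equiv> \<epsilon> 1 2"

lemma e_cases: "e = 1 \<or> e = - 1"
  by (rule sign_choice_cases(1)[OF sign])

text \<open>The roots of type \<open>(1,0)\<close> are \<open>\<alpha>\<^sub>1\<^sub>2, \<alpha>\<^sub>2\<^sub>3, \<alpha>\<^sub>3\<^sub>1\<close> if \<open>e = 1\<close> and their negatives if \<open>e = -1\<close>.\<close>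

definition hol :: "mat3 \<Rightarrow> nat \<Rightarrow> complex" where
  "hol U k = (if e = 1 then [U $ 1 $ 2, U $ 2 $ 3, U $ 3 $ 1] ! k else [U $ 2 $ 1, U $ 3 $ 2, U $ 1 $ 3] ! k)"

text \<open>The weights of the Hermitian form on (1,0) vectors in the coordinates
  \<open>hol\<close>. The factor is 6, not 12, because only one entry of each conjugate pair is
  nonzero.\<close>

definition wt :: "nat \<Rightarrow> complex" where
  "wt k = 6 * of_real ([x, y, z] ! k)"

text \<open>The values at \<open>H\<close> of the three (1,0) roots, in the order of
  \<open>hol\<close>; they are the eigenvalues of ad \<open>H\<close> on (1,0) vectors.\<close>

definition root_val :: "mat3 \<Rightarrow> nat \<Rightarrow> complex" where
  "root_val H k = of_real e * [H $ 1 $ 1 - H $ 2 $ 2, H $ 2 $ 2 - H $ 3 $ 3, H $ 3 $ 3 - H $ 1 $ 1] ! k"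

lemma T10_nth:
  assumes "J U = cscale \<i> U" "i \<noteq> j" "\<epsilon> i j \<noteq> 1"
  shows "U $ i $ j = 0"
proof -
  have "J U $ i $ j = cscale \<i> U $ i $ j" using assms(1) by simp
  then show ?thesis using assms(3) by simp
qed

lemma eps_values: "\<epsilon> 2 3 = e" "\<epsilon> 3 1 = e" "\<epsilon> 2 1 = - e" "\<epsilon> 3 2 = - e" "\<epsilon> 1 3 = - e"
  using cyclic sign_choice_swap[OF sign, of 1 2] sign_choice_swap[OF sign, of 2 3]
    sign_choice_swap[OF sign, of 1 3] by simp_all

lemma T10_zero:
  assumes "J U = cscale \<i> U"
  shows "e = 1 \<Longrightarrow> U $ 2 $ 1 = 0" "e = 1 \<Longrightarrow> U $ 3 $ 2 = 0" "e = 1 \<Longrightarrow> U $ 1 $ 3 = 0"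
    "e \<noteq> 1 \<Longrightarrow> U $ 1 $ 2 = 0" "e \<noteq> 1 \<Longrightarrow> U $ 2 $ 3 = 0" "e \<noteq> 1 \<Longrightarrow> U $ 3 $ 1 = 0"
  by (rule T10_nth[OF assms]; simp add: eps_values)+

lemma metricC_T10:
  assumes "J U = cscale \<i> U" "J V = cscale \<i> V"
  shows "metricC x y z U (mconj V) = (\<Sum>k<3. hol U k * (wt k * cnj (hol V k)))"
  using T10_zero[OF assms(1)] T10_zero[OF assms(2)]
  by (cases "e = 1") (simp_all add: metricC_def mconj_def hol_def wt_def sum_lessThan_3 algebra_simps)

lemma metricC_ad:
  assumes "J U = cscale \<i> U" and H: "diagonal H"
  shows "metricC x y z (mm_part (comm H U)) (mconj U) = (\<Sum>k<3. wt k * (root_val H k * hol U k) * cnj (hol U k))"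
  using T10_zero[OF assms(1)] e_cases
  by (cases "e = 1")
    (simp_all add: metricC_def mconj_def hol_def wt_def root_val_def sum_lessThan_3 comm_diagonal_nth[OF H] algebra_simps)

text \<open>Normalised elementary matrices at the (1,0) roots form a unitary frame, so the choice in
  \<open>some_unitary_frame\<close> is a genuine frame.\<close>

lemma unitary_frame_some: "unitary_frame g J (some_unitary_frame g J)"
proof -
  define c where "c k = 1 / sqrt (6 * [x, y, z] ! k)" for k
  define u :: "nat \<Rightarrow> mat3" where "u k = cscale (of_real (c k))
    (if e = 1 then [unit_mat 1 2, unit_mat 2 3, unit_mat 3 1] ! k
     else [unit_mat 2 1, unit_mat 3 2, unit_mat 1 3] ! k)" for k
  have u: "u k \<in> mm_complex \<and> J (u k) = cscale \<i> (u k)" if "k < 3" for k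
    using less_3_cases[OF that] e_cases
    by (elim disjE) (simp_all add: u_def mm_complex_iff vec_eq_iff forall_3 unit_mat_def eps_values)
  have c: "of_real (c k) * wt k * of_real (c k) = 1" if "k < 3" for k
  proof -
    have "[x, y, z] ! k > 0" using less_3_cases[OF that] pos by (elim disjE) simp_all
    then have "c k * (6 * [x, y, z] ! k) * c k = 1" by (simp add: c_def)
    then have "complex_of_real (c k * (6 * [x, y, z] ! k) * c k) = 1" by simp
    then show ?thesis by (simp add: wt_def)
  qed
  have hol: "hol (u i) k = (if i = k then of_real (c i) else 0)" if "i < 3" "k < 3" for i k
    using less_3_cases[OF that(1)] less_3_cases[OF that(2)] e_cases
    by (elim disjE) (simp_all add: u_def hol_def unit_mat_def)
  have orth: "metricC x y z (u i) (mconj (u j)) = (if i = j then 1 else 0)" if "i < 3" "j < 3" for i j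
  proof -
    have "metricC x y z (u i) (mconj (u j))
      = (\<Sum>k<3. (if i = k then of_real (c i) else 0) * (wt k * cnj (if j = k then of_real (c j) else 0)))"
      using u that by (simp add: metricC_T10 hol)
    also have "\<dots> = (\<Sum>k<3. if k = i then (if i = j then of_real (c i) * wt i * of_real (c i) else 0) else 0)"
      by (intro sum.cong refl) auto
    finally show ?thesis using that c by simp
  qed
  have "unitary_frame g J u"
    unfolding unitary_frame_def using u orth cext2_metric mconj_mm_complex by simp
  then show ?thesis unfolding some_unitary_frame_def by (rule someI[of "unitary_frame g J"])
qed

lemma torus_act_linear: "torus_act a b (A + cscale \<i> B) = torus_act a b A + cscale \<i> (torus_act a b B)"
  by (rule mat3_eqI) (simp add: torus_act_def comm_nth matrix_mult_nth algebra_simps)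

lemma torus_act_mm: "a \<in> mm \<Longrightarrow> b \<in> mm \<Longrightarrow> c \<in> mm \<Longrightarrow> torus_act a b c \<in> mm"
  by (elim mm_cases) (simp add: torus_act_mk Let_def)

lemma diagonal_torus_part: "diagonal (A - mm_part A)"
  by (simp add: diagonal_def)

lemma chern_scalar_zero:
  assumes p: "p \<in> SU3"
  shows "chern_scalar g J D p = 0"
proof -
  define u where "u = some_unitary_frame g J"
  have u: "u i \<in> mm_complex" "J (u i) = cscale \<i> (u i)" if "i < 3" for i
    using unitary_frame_some that by (simp_all add: u_def unitary_frame_def)
  have orth: "(\<Sum>k<3. hol (u i) k * (wt k * cnj (hol (u j) k))) = (if i = j then 1 else 0)"
    if "i < 3" "j < 3" for i j
  proof -
    have "cext2 (\<lambda>a b. of_real (g a b)) (u i) (mconj (u j)) = (if i = j then 1 else 0)"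
      using unitary_frame_some that unfolding u_def unitary_frame_def by blast
    then show ?thesis
      unfolding cext2_metric[OF u(1)[OF that(1)] mconj_mm_complex[OF u(1)[OF that(2)]]]
        metricC_T10[OF u(2)[OF that(1)] u(2)[OF that(2)]] .
  qed
  let ?R = "\<lambda>a b c d. complex_of_real (curvature_at g (gauduchon g J D 1) p a b c d)"
  \<comment> \<open>For real \<open>a\<close> and \<open>b\<close> the sum over \<open>j\<close> is
    the trace of ad \<open>?H\<close> on (1,0) vectors, which is zero.\<close>
  have R2: "(\<Sum>j<3. cext2 (?R a b) (u j) (mconj (u j))) = 0" if "a \<in> mm" "b \<in> mm" for a b
  proof -
    let ?H = "comm a b - mm_part (comm a b)"
    have "cext2 (?R a b) (u j) (mconj (u j)) = metricC x y z (torus_act a b (u j)) (mconj (u j))" if "j < 3" for j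
      using u(1)[OF that] \<open>a \<in> mm\<close> \<open>b \<in> mm\<close>
      by (intro cext2_eq[where F = "\<lambda>c d. metricC x y z (torus_act a b c) d"])
        (simp_all add: curvature_at_gauduchon[OF p] inv_metric_mm torus_act_mm torus_act_linear
          metricC_linear mconj_mm_complex)
    then have "(\<Sum>j<3. cext2 (?R a b) (u j) (mconj (u j)))
      = (\<Sum>j<3. \<Sum>k<3. wt k * (root_val ?H k * hol (u j) k) * cnj (hol (u j) k))"
      by (intro sum.cong refl) (simp add: torus_act_def metricC_ad[OF u(2) diagonal_torus_part])
    also have "\<dots> = 0"
      by (rule weighted_trace_zero[OF orth]) (simp_all add: root_val_def sum_lessThan_3 algebra_simps)
    finally show ?thesis .
  qed
  \<comment> \<open>Extension in the first two slots only forms complex combinations of these zero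
    traces.\<close>
  have R4: "(\<Sum>j<3. cext4 ?R A B (u j) (mconj (u j))) = 0" if "A \<in> mm_complex" "B \<in> mm_complex" for A B
    using R2 mre_mm mim_mm that
    by (simp add: cext4_def cext3_def cext_def[of _ A] cext_def[of _ B] sum.distrib flip: sum_distrib_left)
  show ?thesis
    unfolding chern_scalar_def hermitian_scalar_def u_def[symmetric] Let_def
    by (rule sum.neutral, rule ballI, rule R4) (simp_all add: u(1) mconj_mm_complex)
qed

subsection \<open>The Gray-Hervella class\<close>

lemma bounded_bilinear_fund_form: "bounded_bilinear (fund_form g J)"
proof -
  interpret g: bounded_bilinear g by (rule bounded_bilinear_inv_metric)
  show ?thesis
    unfolding bilinear_conv_bounded_bilinear[symmetric]
    by (rule bilinear_intro) (simp_all add: fund_form_def J_add linear_scale[OF linear_inv_acs]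
        g.add_left g.add_right g.scaleR_left g.scaleR_right)
qed

lemma g_J: "a \<in> mm \<Longrightarrow> b \<in> mm \<Longrightarrow> g (J a) b = - g a (J b)"
  by (rule inv_metric_inv_acs[OF sign])

lemma fund_form_antisym: "a \<in> mm \<Longrightarrow> b \<in> mm \<Longrightarrow> fund_form g J b a = - fund_form g J a b"
  using g_J[of b a] inv_metric_sym[of x y z b "J a"] by (simp add: fund_form_def)

text \<open>The Chevalley-Eilenberg differential of the invariant form, in which only bracket terms
  occur.\<close>

definition dF :: "mat3 \<Rightarrow> mat3 \<Rightarrow> mat3 \<Rightarrow> real" where
  "dF a b c = - fund_form g J (mm_part (comm a b)) c - fund_form g J (mm_part (comm b c)) a
     - fund_form g J (mm_part (comm c a)) b"

text \<open>The derivatives from the product rule cancel against those in the Lie brackets by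
  antisymmetry of the form.\<close>

lemma dF_at_eq:
  assumes p: "p \<in> SU3" and abc: "a \<in> mm" "b \<in> mm" "c \<in> mm"
  shows "dF_at g J p a b c = of_real (dF a b c)"
proof -
  interpret F: bounded_bilinear "fund_form g J" by (rule bounded_bilinear_fund_form)
  define X Y Z where "X = extend p a" and "Y = extend p b" and "Z = extend p c"
  have V: "smooth_vfield X" "smooth_vfield Y" "smooth_vfield Z" "X p = a" "Y p = b" "Z p = c"
    unfolding X_def Y_def Z_def using smooth_vfield_extend extend_at_base[OF p] abc by auto
  have d: "vderiv U (\<lambda>q. fund_form g J (V q) (W q)) p
      = fund_form g J (V p) (left_deriv W p (U p)) + fund_form g J (left_deriv V p (U p)) (W p)"
    if "smooth_vfield U" "smooth_vfield V" "smooth_vfield W" for U V W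
    unfolding vderiv_def
    by (rule left_deriv_bilinear[OF bounded_bilinear_fund_form vfieldD(5)[OF that(2) p]
          vfieldD(5)[OF that(3) p] p vfieldD(3)[OF that(1) p]])
  have mm: "left_deriv U p (V p) \<in> mm" if "smooth_vfield U" "smooth_vfield V" for U V
    using vfieldD(6)[OF that(1) p vfieldD(3)[OF that(2) p]] .
  have as: "fund_form g J (W p) (left_deriv U p (V p)) = - fund_form g J (left_deriv U p (V p)) (W p)"
    if "smooth_vfield U" "smooth_vfield V" "smooth_vfield W" for U V W
    using fund_form_antisym[OF mm[OF that(1,2)] vfieldD(2)[OF that(3) p]] .
  have "ext_deriv (fund_form g J) X Y Z p = dF (X p) (Y p) (Z p)"
    unfolding ext_deriv_def d[OF V(1,2,3)] d[OF V(2,3,1)] d[OF V(3,1,2)]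
      lie_bracket_eq[OF V(1,2) p] lie_bracket_eq[OF V(2,3) p] lie_bracket_eq[OF V(3,1) p] dF_def
      as[OF V(1,2,3)] as[OF V(2,3,1)] as[OF V(3,1,2)] as[OF V(1,3,2)] as[OF V(2,1,3)] as[OF V(3,2,1)]
    by (simp add: F.add_left F.diff_left)
  then show ?thesis
    unfolding dF_at_def X_def[symmetric] Y_def[symmetric] Z_def[symmetric] V(4-6) by simp
qed

lemma fund_form_J: "a \<in> mm \<Longrightarrow> b \<in> mm \<Longrightarrow> fund_form g J (- J a) b = g a b"
  "a \<in> mm \<Longrightarrow> b \<in> mm \<Longrightarrow> fund_form g J a (J b) = g a b"
proof -
  interpret g: bounded_bilinear g by (rule bounded_bilinear_inv_metric)
  assume ab: "a \<in> mm" "b \<in> mm"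
  show "fund_form g J (- J a) b = g a b" by (simp add: fund_form_def J_minus J_J ab)
  show "fund_form g J a (J b) = g a b"
    using g_J[OF ab(1) J_mm[OF ab(2)]] by (simp add: fund_form_def J_J ab g.minus_right)
qed

text \<open>These identities say that \<open>dF\<close> is of type \<open>(3,0) + (0,3)\<close>.\<close>

lemma dF_J:
  assumes abc: "a \<in> mm" "b \<in> mm" "c \<in> mm"
  shows "dF a (J b) c = dF (J a) b c" "dF a b (J c) = dF (J a) b c" "dF (J a) (J b) c = - dF a b c"
proof -
  interpret g: bounded_bilinear g by (rule bounded_bilinear_inv_metric)
  \<comment> \<open>The common value of \<open>dF\<close> with one \<open>J\<close> inserted,
    whichever slot it is in.\<close>
  define \<Theta> where "\<Theta> a b c = - g (mm_part (comm a b)) c - g (mm_part (comm b c)) a - g (mm_part (comm c a)) b" for a b c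
  have 1: "dF (J a) b c = \<Theta> a b c" "dF a (J b) c = \<Theta> a b c" "dF a b (J c) = \<Theta> a b c"
    if "a \<in> mm" "b \<in> mm" "c \<in> mm" for a b c
    using that by (simp_all add: dF_def \<Theta>_def comm_J fund_form_J mm_comm)
  have "\<Theta> (J a) b c = - dF a b c"
    using abc g_J[of "mm_part (comm b c)" a]
    by (simp add: dF_def \<Theta>_def comm_J mm_comm fund_form_def g.minus_left)
  then show "dF a (J b) c = dF (J a) b c" "dF a b (J c) = dF (J a) b c" "dF (J a) (J b) c = - dF a b c"
    using 1 abc J_mm by simp_all
qed

lemma mre_type_proj:
  assumes "a \<in> mm"
  shows "mre (type_proj J s a) = (1/2) *\<^sub>R a" "mim (type_proj J s a) = (if s then - 1/2 else 1/2) *\<^sub>R J a"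
proof -
  have a: "cnj (a $ i $ j) = - a $ j $ i" "cnj (J a $ i $ j) = - J a $ j $ i" for i j
    using assms J_mm[OF assms] by (simp_all add: mm_iff skew_cnj del: inv_acs_nth)
  show "mre (type_proj J s a) = (1/2) *\<^sub>R a" "mim (type_proj J s a) = (if s then - 1/2 else 1/2) *\<^sub>R J a"
    by (rule mat3_eqI; simp add: mre_def mim_def mconj_def type_proj_def a scaleR_conv_of_real[where 'a=complex]
        field_simps del: inv_acs_nth)+
qed

lemma trilinear_dF:
  "dF (r *\<^sub>R a) b c = r * dF a b c" "dF a (r *\<^sub>R b) c = r * dF a b c" "dF a b (r *\<^sub>R c) = r * dF a b c"
proof -
  interpret F: bounded_bilinear "fund_form g J" by (rule bounded_bilinear_fund_form)
  interpret cm: bounded_bilinear comm by (rule bounded_bilinear_comm)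
  show "dF (r *\<^sub>R a) b c = r * dF a b c" "dF a (r *\<^sub>R b) c = r * dF a b c" "dF a b (r *\<^sub>R c) = r * dF a b c"
    by (simp_all add: dF_def cm.scaleR_left cm.scaleR_right linear_scale[OF linear_mm_part]
        F.scaleR_left F.scaleR_right algebra_simps)
qed

lemma plus_part_dF_zero:
  assumes p: "p \<in> SU3" and abc: "a \<in> mm" "b \<in> mm" "c \<in> mm"
  shows "plus_part J (dF_at g J p) a b c = 0"
proof -
  have mm: "r *\<^sub>R u \<in> mm" if "u \<in> mm" for r u using subspace_scale[OF subspace_mm that] .
  have neg: "- u \<in> mm" if "u \<in> mm" for u using subspace_neg[OF subspace_mm that] .
  have dF_minus: "dF (- u) v w = - dF u v w" "dF u (- v) w = - dF u v w" "dF u v (- w) = - dF u v w" for u v w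
    using trilinear_dF(1)[of "- 1" u] trilinear_dF(2)[of u "- 1" v] trilinear_dF(3)[of u v "- 1" w] by simp_all
  note J_abc = J_mm[OF abc(1)] J_mm[OF abc(2)] J_mm[OF abc(3)]
  \<comment> \<open>All placements of \<open>J\<close> are reduced to \<open>dF a b c\<close> and
    \<open>dF (J a) b c\<close>, after which each mixed component cancels.\<close>
  have JJJ: "dF (J a) (J b) (J c) = - dF (J a) b c" "dF (J a) b (J c) = - dF a b c" "dF a (J b) (J c) = - dF a b c"
    using dF_J[OF J_abc(1) abc(2,3)] dF_J[OF abc] dF_J[OF abc(1) J_abc(2) abc(3)] dF_J[OF abc(1,2) J_abc(3)]
      dF_J[OF J_abc(1,2) abc(3)] dF_J[OF J_abc(1) abc(2) J_abc(3)] dF_J(3)[OF abc(1,2) J_abc(3)] by simp_all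
  have "cext3 (dF_at g J p) (type_proj J r a) (type_proj J s b) (type_proj J t c) = 0"
    if "\<not> (r = s \<and> s = t)" for r s t
    using that
    by (cases r; cases s; cases t)
      (simp_all add: cext3_def cext2_def cext_def mre_type_proj abc J_abc mm neg dF_at_eq[OF p] trilinear_dF dF_minus
        dF_J[OF abc] JJJ algebra_simps)
  then show ?thesis unfolding plus_part_def by (intro sum.neutral) auto
qed

lemma lee_form_zero:
  assumes p: "p \<in> SU3" and a: "a \<in> mm"
  shows "lee_form g J D p a = 0"
proof -
  interpret F: bounded_bilinear "fund_form g J" by (rule bounded_bilinear_fund_form)
  interpret L: bounded_bilinear \<Lambda> by (rule bounded_bilinear_nomizu)
  define b where "b = J a"
  have b: "b \<in> mm" using J_mm[OF a] by (simp add: b_def)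
  \<comment> \<open>On the diagonal this is minus the covariant derivative of the form; the left
    derivatives drop out.\<close>
  define h where "h u v = fund_form g J (\<Lambda> u v) b + fund_form g J v (\<Lambda> u b)" for u v
  have cov: "cov_form D (fund_form g J) (extend p u) (extend p u) (extend p b) p = - h u u" if u: "u \<in> mm" for u
  proof -
    note U = smooth_vfield_extend[OF u, of p] and B = smooth_vfield_extend[OF b, of p]
    have d: "vderiv (extend p u) (\<lambda>q. fund_form g J (extend p u q) (extend p b q)) p
      = fund_form g J u (left_deriv (extend p b) p u) + fund_form g J (left_deriv (extend p u) p u) b"
      using left_deriv_bilinear[OF bounded_bilinear_fund_form vfieldD(5)[OF U p] vfieldD(5)[OF B p] p
          vfieldD(3)[OF U p]]
      by (simp add: vderiv_def extend_at_base[OF p] u b)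
    show ?thesis
      unfolding cov_form_def d D_eq[OF U U p] D_eq[OF U B p]
      by (simp add: extend_at_base[OF p] u b h_def F.add_left F.add_right)
  qed
  have "bilinear h"
    by (rule bilinear_intro) (simp_all add: h_def F.add_left F.add_right F.scaleR_left F.scaleR_right
        L.add_left L.add_right L.scaleR_left L.scaleR_right algebra_simps)
  note tr = frame_trace[OF orthonormal_frame_some_frame this]
  have e_mm: "some_frame g i \<in> mm" if "i < 6" for i
    using orthonormal_frame_some_frame that by (simp add: orthonormal_frame_def)
  \<comment> \<open>For \<open>u\<close> in a single summand, \<open>\<Lambda> u u\<close> vanishes
    and \<open>\<Lambda> u b\<close> has no component in that summand, which \<open>J\<close>
    preserves.\<close>
  have "h (bv k) (bv k) = 0" if "k < 6" for k
  proof -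
    obtain u v w where buv: "b = mk u v w" using mm_cases[OF b] .
    show ?thesis
      using less_6_cases[OF that]
      by (elim disjE; simp only: bv_simps h_def buv fund_form_def nomizu_mk J_mk inv_metric_mk; simp)
  qed
  then have "(\<Sum>i<6. h (some_frame g i) (some_frame g i)) = 0"
    unfolding tr by (intro sum.neutral) simp
  then show ?thesis
    by (simp add: lee_form_def codiff_F_def cov e_mm sum_negf flip: b_def)
qed

text \<open>The whole (2,1) + (1,2) part of the differential is zero, so the Lefschetz decomposition
  holds with zero one-form.\<close>

lemma in_W1_W2: "in_W1_W2 g J D"
  unfolding in_W1_W2_def is_primitive_part_def primitive_form_def
  by (auto simp: plus_part_dF_zero lee_form_zero intro!: exI[of _ "\<lambda>_. 0"] linear_zero)

end

section \<open>The quadratic equation for the third metric parameter\<close>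

lemma scalar_zero_iff:
  fixes x y z :: real
  assumes pos: "x > 0" "y > 0" "z > 0"
  shows "6 * (x * y + y * z + z * x) - (x\<^sup>2 + y\<^sup>2 + z\<^sup>2) = 0 \<longleftrightarrow>
    (z = 3 * (x + y) - 2 * sqrt 2 * sqrt (x\<^sup>2 + 3 * x * y + y\<^sup>2) \<and> x > 0 \<and>
        (y > (2 * sqrt 2 + 3) * x \<or> 0 < y \<and> y < (3 - 2 * sqrt 2) * x)) \<or>
     (z = 2 * sqrt 2 * sqrt (x\<^sup>2 + 3 * x * y + y\<^sup>2) + 3 * (x + y) \<and> x > 0 \<and> y > 0)"
proof -
  define r where "r = 2 * sqrt 2 * sqrt (x\<^sup>2 + 3 * x * y + y\<^sup>2)"
  have r: "r \<ge> 0" "r\<^sup>2 = 8 * (x\<^sup>2 + 3 * x * y + y\<^sup>2)"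
    using pos by (simp_all add: r_def power_mult_distrib)
  \<comment> \<open>Completing the square in \<open>z\<close>; the two roots are centred at
    \<open>3 * (x + y)\<close>.\<close>
  have "6 * (x * y + y * z + z * x) - (x\<^sup>2 + y\<^sup>2 + z\<^sup>2) = r\<^sup>2 - (z - 3 * (x + y))\<^sup>2"
    unfolding r by (simp add: power2_eq_square algebra_simps)
  then have 1: "6 * (x * y + y * z + z * x) - (x\<^sup>2 + y\<^sup>2 + z\<^sup>2) = 0 \<longleftrightarrow>
      z = 3 * (x + y) - r \<or> z = r + 3 * (x + y)"
    using power2_eq_iff[of r "z - 3 * (x + y)"] by auto
  \<comment> \<open>Positivity of the smaller root gives \<open>r < 3 * (x + y)\<close>, that is
    \<open>x^2 - 6*x*y + y^2 > 0\<close>. This quadratic in \<open>y\<close> has the roots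
    \<open>(3 + 2 * sqrt 2) * x\<close> and \<open>(3 - 2 * sqrt 2) * x\<close>, so \<open>y\<close>
    lies outside the interval between them.\<close>
  have 2: "y > (2 * sqrt 2 + 3) * x \<or> y < (3 - 2 * sqrt 2) * x" if "z = 3 * (x + y) - r"
  proof (rule ccontr)
    assume "\<not> ?thesis"
    then have "(y - (2 * sqrt 2 + 3) * x) * (y - (3 - 2 * sqrt 2) * x) \<le> 0"
      by (intro mult_nonpos_nonneg) auto
    moreover have "(y - (2 * sqrt 2 + 3) * x) * (y - (3 - 2 * sqrt 2) * x) = (3 * (x + y))\<^sup>2 - r\<^sup>2"
      unfolding r using real_sqrt_mult_self[of 2] by (simp add: power2_eq_square algebra_simps)
    moreover have "r\<^sup>2 < (3 * (x + y))\<^sup>2"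
      using that pos r(1) by (intro power_strict_mono) auto
    ultimately show False by simp
  qed
  show ?thesis
    unfolding 1 r_def[symmetric] using 2 pos by auto
qed

theorem theorem1p3:
  fixes x y z :: real and \<epsilon> :: "3 \<Rightarrow> 3 \<Rightarrow> real"
    and g :: "mat3 \<Rightarrow> mat3 \<Rightarrow> real" and J :: "mat3 \<Rightarrow> mat3"
    and D :: "vfield \<Rightarrow> vfield \<Rightarrow> vfield"
  assumes "x > 0" and "y > 0" and "z > 0"
    and "g = inv_metric x y z"
    and "sign_choice \<epsilon>" and "J = inv_acs \<epsilon>" and "\<not> integrable_acs J"
    and "levi_civita g D"
  shows "(\<forall>p\<in>SU3. 2 * chern_scalar g J D p - of_real (scalar_curvature g D p) = 0) \<longleftrightarrow>
    in_W1_W2 g J D \<and>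
    ((z = 3 * (x + y) - 2 * sqrt 2 * sqrt (x\<^sup>2 + 3 * x * y + y\<^sup>2) \<and> x > 0 \<and>
        (y > (2 * sqrt 2 + 3) * x \<or> 0 < y \<and> y < (3 - 2 * sqrt 2) * x)) \<or>
     (z = 2 * sqrt 2 * sqrt (x\<^sup>2 + 3 * x * y + y\<^sup>2) + 3 * (x + y) \<and> x > 0 \<and> y > 0))"
proof -
  interpret flag_metric x y z D
    using assms by unfold_locales auto
  \<comment> \<open>Any other sign pattern would make \<open>J\<close> integrable.\<close>
  have "\<epsilon> 1 2 = \<epsilon> 2 3" "\<epsilon> 1 3 = - \<epsilon> 1 2"
    using integrable_inv_acs assms(5-7) by blast+
  then interpret cyclic_acs x y z D \<epsilon>
    using assms(5) by unfold_locales auto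
  define S where "S = (6 * (x * y + y * z + z * x) - (x\<^sup>2 + y\<^sup>2 + z\<^sup>2)) / (6 * x * y * z)"
  \<comment> \<open>Both curvatures are constant on the group; the identity matrix serves as a point
    at which to evaluate them.\<close>
  have "(\<forall>p\<in>SU3. 2 * chern_scalar g J D p - of_real (scalar_curvature g D p) = 0) \<longleftrightarrow> S = 0"
    unfolding assms(4,6)
    using mat_1_in_SU3 by (auto simp: chern_scalar_zero scalar_curvature_eq[folded S_def])
  also have "\<dots> \<longleftrightarrow> 6 * (x * y + y * z + z * x) - (x\<^sup>2 + y\<^sup>2 + z\<^sup>2) = 0"
    using assms(1-3) unfolding S_def divide_eq_0_iff by simp
  finally have "(\<forall>p\<in>SU3. 2 * chern_scalar g J D p - of_real (scalar_curvature g D p) = 0) \<longleftrightarrow>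
      6 * (x * y + y * z + z * x) - (x\<^sup>2 + y\<^sup>2 + z\<^sup>2) = 0" .
  then show ?thesis
    using in_W1_W2 unfolding assms(4,6) scalar_zero_iff[OF assms(1-3)] by blast
qed

end
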